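(* For every $\varepsilon \geq 0$ and every $n \in \mathbb{N}$, and every $p$ with $\frac{2000 \log n}{n} \leq p \leq n^{-\frac12 - \varepsilon}$, there exists an algorithm in the distance query model that reconstructs $G \sim G(n,p)$ (i.e. determines its edge set exactly) using $O(\Delta^2 n \log n)$ queries in expectation, where $\Delta = (n-1)p$ is the expected average degree of $G$.
   Context: Distance query model: we are given the vertex set $V$ of an $n$-vertex graph $G=(V,E)$ (with $E$ hidden) and an oracle which, on input two vertices $u,v \in V$, returns the shortest-path distance $d_G(u,v)$ in $G$. Each call to the oracle is one query; reconstructing $G$ means determining $E$ exactly. $G(n,p)$ denotes the Erdős–Rényi–Gilbert random graph on $n$ vertices in which each pair is an edge independently with probability $p$. The expectation is over both the randomness of $G$ and the internal randomness of the algorithm. $\log$ denotes the natural logarithm. *)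

theory Defs
  imports "HOL-Probability.Probability"
begin

(* Graphs on vertex set V = {0..<n}: an edge set is a set of pairs (u,v) with u < v < n. *)
type_synonym edges = "(nat \<times> nat) set"

definition vpairs :: "nat \<Rightarrow> (nat \<times> nat) set" where
  "vpairs n = {(u, v). u < v \<and> v < n}"

definition adj :: "edges \<Rightarrow> nat \<Rightarrow> nat \<Rightarrow> bool" where
  "adj E a b \<longleftrightarrow> a \<noteq> b \<and> (min a b, max a b) \<in> E"

definition walk :: "edges \<Rightarrow> nat \<Rightarrow> nat \<Rightarrow> nat \<Rightarrow> bool" where
  "walk E u v k \<longleftrightarrow> (\<exists>xs. length xs = Suc k \<and> xs ! 0 = u \<and> xs ! k = v \<and>
       (\<forall>i<k. adj E (xs ! i) (xs ! Suc i)))"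

definition gdist :: "edges \<Rightarrow> nat \<Rightarrow> nat \<Rightarrow> enat" where
  "gdist E u v = (if \<exists>k. walk E u v k then enat (LEAST k. walk E u v k) else \<infinity>)"

definition Gnp :: "nat \<Rightarrow> real \<Rightarrow> edges pmf" where
  "Gnp n p = map_pmf (\<lambda>f. {e \<in> vpairs n. f e})
                     (Pi_pmf (vpairs n) False (\<lambda>_. bernoulli_pmf p))"

(* Distance query model: a deterministic adaptive strategy maps the transcript
   so far (queried pairs and oracle answers) to the next action. *)
datatype action = Query nat nat | Output edges

type_synonym history = "((nat \<times> nat) \<times> enat) list"
type_synonym strategy = "history \<Rightarrow> action"

fun transcript :: "strategy \<Rightarrow> edges \<Rightarrow> nat \<Rightarrow> history" where
  "transcript S E 0 = []"
| "transcript S E (Suc k) =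
     (let h = transcript S E k in
      case S h of Query u v \<Rightarrow> h @ [((u, v), gdist E u v)] | Output F \<Rightarrow> h)"

definition halted :: "strategy \<Rightarrow> edges \<Rightarrow> nat \<Rightarrow> bool" where
  "halted S E k \<longleftrightarrow> (\<exists>F. S (transcript S E k) = Output F)"

definition num_queries :: "strategy \<Rightarrow> edges \<Rightarrow> enat" where
  "num_queries S E = (if \<exists>k. halted S E k then enat (LEAST k. halted S E k) else \<infinity>)"

definition reconstructs :: "strategy \<Rightarrow> edges \<Rightarrow> bool" where
  "reconstructs S E \<longleftrightarrow> (\<exists>k. S (transcript S E k) = Output E)"

(* A randomized algorithm is a distribution over deterministic strategies (internal randomness). *)
definition expected_queries :: "strategy pmf \<Rightarrow> edges pmf \<Rightarrow> ennreal" where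
  "expected_queries A D =
     (\<integral>\<^sup>+ x. ennreal_of_enat (num_queries (snd x) (fst x)) \<partial>measure_pmf (pair_pmf D A))"

end

(* Query all distances from m = O(Delta^2 log n) uniformly random seeds, then query every pair u, v
   that no seed s splits, i.e. with |d(s,u) - d(s,v)| <= 1 for all s; every edge is among these pairs.
   It remains to see that a non-adjacent pair is unsplit with probability O(1/n). Let D = n p and let J be
   maximal with D^J <= n/1000. The sphere of radius J - 1 around u has about D^(J-1) vertices, and with
   high probability at least a constant fraction of it avoids the ball of radius J around v in the graph
   without u: given that graph, N(u) is a fresh random set, so a Chernoff bound weighted by the sizes of the
   overlaps of balls of radius J - 2 with the ball around v applies. All these vertices split the pair, and
   they make up a fraction of order at least 1/D^2 of the graph, so O(D^2 log n) seeds hit one of them with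
   probability 1 - 1/n. The sphere sizes are controlled by peeling off the root: the layers of A in V are
   A followed by the layers of F = N(A) in V - F, and F is independent of the edges inside V. If J < 2, then
   querying all pairs is affordable. *)

theory Submission
  imports Defs
begin

section \<open>Random edge sets and a Chernoff bound\<close>

text \<open>The radii fit a gap of two: a vertex within distance J - 1 of u splits the pair once it
  is farther than J from v, so the ball to be avoided has radius J. That ball has at most 3 D^J <=
  3n/1000 vertices, few enough for most of the sphere around u to miss it, while maximality of J
  gives D^(J-1) > n/(1000 D^2), which fixes the number of seeds. The obstacle is dependence: the
  sphere around u and the ball around v read the same edges, and the branches of the sphere meet the
  ball in unequal amounts. Without u, the ball and the branches are determined by edges that do not
  join u to the rest, so the overlap is a weighted sum over a fresh neighbourhood, and double
  counting controls its mean. Each Chernoff step fails with probability at most n^-3, from exponents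
  of at least D/128 and D >= 2000 log n; this survives a union bound over n roots and at most n
  levels. The remaining O(1/n) per pair adds O(n) false candidates in expectation, and the true
  edges O(n D); both are below D^2 n log n. Chance affects only the number of queries: the output is
  correct for every list of seeds.\<close>

definition random_edges :: "edges \<Rightarrow> real \<Rightarrow> edges pmf" where
  "random_edges Q p = map_pmf (\<lambda>f. {e \<in> Q. f e}) (Pi_pmf Q False (\<lambda>_. bernoulli_pmf p))"

text \<open>Potential edges, normalised to (min, max) as in \<open>vpairs\<close>, so that exposing
  the edges between two vertex sets means sampling on this set.\<close>

definition cross :: "nat set \<Rightarrow> nat set \<Rightarrow> edges" where
  "cross A V = (\<lambda>(a, y). (min a y, max a y)) ` (A \<times> V)"

definition nbrs :: "edges \<Rightarrow> nat set \<Rightarrow> nat set \<Rightarrow> nat set" where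
  "nbrs E A V = {y \<in> V. \<exists>a\<in>A. adj E a y}"

text \<open>For disjoint \<open>A\<close> and \<open>V\<close> these are the breadth-first spheres
  of \<open>A\<close> in the graph induced on the union. Edges inside \<open>A\<close> are never
  read, which is what keeps later layers independent of what has been exposed.\<close>

fun layer :: "edges \<Rightarrow> nat \<Rightarrow> nat set \<Rightarrow> nat set \<Rightarrow> nat set" where
  "layer E 0 A V = A"
| "layer E (Suc k) A V = layer E k (nbrs E A V) (V - nbrs E A V)"

lemma Gnp_eq_random_edges: "Gnp n p = random_edges (vpairs n) p"
  by (simp add: Gnp_def random_edges_def)

lemma finite_vpairs [simp]: "finite (vpairs n)"
  by (rule finite_subset[of _ "{..<n} \<times> {..<n}"]) (auto simp: vpairs_def)

lemma finite_cross [simp]: "finite A \<Longrightarrow> finite V \<Longrightarrow> finite (cross A V)"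
  by (simp add: cross_def)

lemma set_random_edges: "finite Q \<Longrightarrow> E \<in> set_pmf (random_edges Q p) \<Longrightarrow> E \<subseteq> Q"
  by (auto simp: random_edges_def)

lemma random_edges_empty [simp]: "random_edges {} p = return_pmf {}"
  by (simp add: random_edges_def map_pmf_const)

text \<open>Independence of disjoint sets of potential edges; every step-by-step exposure of the
  graph rests on this product form.\<close>

lemma random_edges_Un:
  assumes "finite Q1" "finite Q2" "Q1 \<inter> Q2 = {}"
  shows "random_edges (Q1 \<union> Q2) p =
    map_pmf (\<lambda>(E1, E2). E1 \<union> E2) (pair_pmf (random_edges Q1 p) (random_edges Q2 p))"
proof -
  have "random_edges (Q1 \<union> Q2) p =
      map_pmf (\<lambda>(f, g). {e \<in> Q1. f e} \<union> {e \<in> Q2. g e})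
        (pair_pmf (Pi_pmf Q1 False (\<lambda>_. bernoulli_pmf p)) (Pi_pmf Q2 False (\<lambda>_. bernoulli_pmf p)))"
    unfolding random_edges_def Pi_pmf_union[OF assms] pmf.map_comp
    using assms(3) by (intro map_pmf_cong refl) (auto split: if_splits)
  also have "\<dots> = map_pmf (\<lambda>(E1, E2). E1 \<union> E2) (pair_pmf (random_edges Q1 p) (random_edges Q2 p))"
    unfolding random_edges_def map_pair[symmetric] pmf.map_comp
    by (intro map_pmf_cong refl) auto
  finally show ?thesis .
qed

lemma random_edges_singleton:
  "random_edges {e} p = map_pmf (\<lambda>b. if b then {e} else {}) (bernoulli_pmf p)"
proof -
  have "random_edges {e} p = map_pmf (\<lambda>f. {x \<in> {e}. f x}) (map_pmf (\<lambda>b x. if x = e then b else False) (bernoulli_pmf p))"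
    unfolding random_edges_def by (simp add: Pi_pmf_singleton)
  also have "\<dots> = map_pmf (\<lambda>b. if b then {e} else {}) (bernoulli_pmf p)"
    unfolding pmf.map_comp by (intro map_pmf_cong refl) auto
  finally show ?thesis .
qed

lemma prob_random_edges_empty:
  assumes "finite Q" "0 \<le> p" "p \<le> 1"
  shows "measure_pmf.prob (random_edges Q p) {{}} = (1 - p) ^ card Q"
  using assms(1)
proof (induction Q)
  case empty
  then show ?case by (simp add: measure_return_pmf)
next
  case (insert e Q)
  have "random_edges (insert e Q) p =
      map_pmf (\<lambda>(E1, E2). E1 \<union> E2) (pair_pmf (random_edges {e} p) (random_edges Q p))"
    using random_edges_Un[of "{e}" Q p] insert by simp
  then have "measure_pmf.prob (random_edges (insert e Q) p) {{}} =
      measure_pmf.prob (pair_pmf (random_edges {e} p) (random_edges Q p)) ({{}} \<times> {{}})"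
    by (simp add: vimage_def) (rule arg_cong[where f="measure_pmf.prob _"], auto)
  also have "\<dots> = measure_pmf.prob (random_edges {e} p) {{}} * measure_pmf.prob (random_edges Q p) {{}}"
    by (rule measure_pmf_prob_product) auto
  also have "measure_pmf.prob (random_edges {e} p) {{}} = 1 - p"
  proof -
    have "(\<lambda>b. if b then {e} else {}) -` {{}} = {False}" by auto
    then have "measure_pmf.prob (random_edges {e} p) {{}} = measure_pmf.prob (bernoulli_pmf p) {False}"
      by (simp add: random_edges_singleton measure_map_pmf del: measure_pmf_single)
    also have "\<dots> = 1 - p" using assms by (simp add: measure_pmf_single)
    finally show ?thesis .
  qed
  finally show ?case using insert by simp
qed

lemma prob_random_edges_mem:
  assumes "finite Q" "e \<in> Q" "0 \<le> p" "p \<le> 1"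
  shows "measure_pmf.prob (random_edges Q p) {E. e \<in> E} = p"
proof -
  have "measure_pmf.prob (random_edges Q p) {E. e \<in> E} =
      measure_pmf.prob (map_pmf (\<lambda>f. f e) (Pi_pmf Q False (\<lambda>_. bernoulli_pmf p))) {True}"
    using assms(2) by (simp add: random_edges_def vimage_def)
  also have "map_pmf (\<lambda>f. f e) (Pi_pmf Q False (\<lambda>_. bernoulli_pmf p)) = bernoulli_pmf p"
    using assms by (simp add: Pi_pmf_component)
  finally show ?thesis using assms by (simp add: measure_pmf_single)
qed

section \<open>Edges between two vertex sets and the neighbourhood they create\<close>

lemma mem_cross_iff: "(min a y, max a y) \<in> cross A V \<longleftrightarrow> (a \<in> A \<and> y \<in> V) \<or> (y \<in> A \<and> a \<in> V)"
proof -
  have eq: "(min a y, max a y) = (min b z, max b z) \<longleftrightarrow> (a = b \<and> y = z) \<or> (a = z \<and> y = b)" for b z :: nat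
    by (auto simp: min_def max_def split: if_splits)
  have "(min a y, max a y) \<in> cross A V \<longleftrightarrow>
      (\<exists>b\<in>A. \<exists>z\<in>V. (min a y, max a y) = (min b z, max b z))"
    unfolding cross_def by auto
  then show ?thesis unfolding eq by blast
qed

lemma adj_sym: "adj E a b \<longleftrightarrow> adj E b a"
  by (auto simp: adj_def min.commute max.commute)

lemma card_cross_singleton:
  assumes "y \<notin> A" shows "card (cross A {y}) = card A"
proof -
  have "inj_on (\<lambda>(a, y). (min a y, max a y)) (A \<times> {y})"
    by (rule inj_onI) (auto simp: min_def max_def split: if_splits)
  then show ?thesis unfolding cross_def by (simp add: card_image card_cartesian_product)
qed

lemma cross_insert_disjoint:
  assumes "y \<notin> V" "A \<inter> insert y V = {}"
  shows "cross A {y} \<inter> cross A V = {}"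
proof -
  have False if "e \<in> cross A {y}" "e \<in> cross A V" for e
  proof -
    from that(1) obtain a where a: "a \<in> A" "e = (min a y, max a y)" by (auto simp: cross_def)
    with that(2) have "(a \<in> A \<and> y \<in> V) \<or> (y \<in> A \<and> a \<in> V)" by (simp add: mem_cross_iff)
    then show False using assms by auto
  qed
  then show ?thesis by auto
qed

text \<open>Whether \<open>y\<close> is hit depends only on \<open>cross A {y}\<close>. These sets
  are disjoint for different \<open>y\<close>, so the hits are independent with probability
  \<open>1 - (1 - p) ^ card A\<close> each, and the exponential moment factorises.\<close>

lemma nn_integral_exp_nbrs:
  assumes "finite A" "finite V" "A \<inter> V = {}" "0 \<le> p" "p \<le> 1"
  shows "(\<integral>\<^sup>+E. ennreal (exp (\<Sum>y\<in>nbrs E A V. g y)) \<partial>random_edges (cross A V) p) =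
    ennreal (\<Prod>y\<in>V. 1 + (1 - (1 - p) ^ card A) * (exp (g y) - 1))"
  using assms(2,3)
proof (induction V)
  case empty
  then show ?case by (simp add: cross_def nbrs_def)
next
  case (insert y V)
  let ?q = "1 - (1 - p) ^ card A"
  have q: "0 \<le> ?q" "?q \<le> 1" using assms(4,5) by (auto intro: power_le_one)
  have fac: "0 \<le> 1 + ?q * (exp (g z) - 1)" for z
  proof -
    have "- 1 \<le> ?q * (- 1)" using q by simp
    also have "\<dots> \<le> ?q * (exp (g z) - 1)" by (rule mult_left_mono) (use q in auto)
    finally show ?thesis by simp
  qed
  have eq: "cross A (insert y V) = cross A {y} \<union> cross A V" by (auto simp: cross_def)
  have disj: "cross A {y} \<inter> cross A V = {}"
    using cross_insert_disjoint[of y V A] insert by auto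
  have yA: "y \<notin> A" and AV: "A \<inter> V = {}" using insert by auto
  have split: "(\<Sum>z\<in>nbrs (E1 \<union> E2) A (insert y V). g z) =
      (if E1 = {} then 0 else g y) + (\<Sum>z\<in>nbrs E2 A V. g z)"
    if E1: "E1 \<subseteq> cross A {y}" and E2: "E2 \<subseteq> cross A V" for E1 E2
  proof -
    have 1: "adj (E1 \<union> E2) a z \<longleftrightarrow> adj E2 a z" if "a \<in> A" "z \<in> V" for a z
    proof -
      have "(min a z, max a z) \<notin> cross A {y}" using that insert by (auto simp: mem_cross_iff)
      then show ?thesis using E1 by (auto simp: adj_def)
    qed
    have 2: "(\<exists>a\<in>A. adj (E1 \<union> E2) a y) \<longleftrightarrow> E1 \<noteq> {}"
    proof
      assume "\<exists>a\<in>A. adj (E1 \<union> E2) a y"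
      then obtain a where a: "a \<in> A" "adj (E1 \<union> E2) a y" by auto
      have "(min a y, max a y) \<notin> cross A V" using a insert by (auto simp: mem_cross_iff)
      then show "E1 \<noteq> {}" using a E2 by (auto simp: adj_def)
    next
      assume "E1 \<noteq> {}"
      then obtain e where "e \<in> E1" "e \<in> cross A {y}" using E1 by blast
      then obtain a where "a \<in> A" "(min a y, max a y) \<in> E1" by (auto simp: cross_def)
      then show "\<exists>a\<in>A. adj (E1 \<union> E2) a y" using yA by (auto simp: adj_def)
    qed
    have "nbrs (E1 \<union> E2) A (insert y V) = (if E1 = {} then {} else {y}) \<union> nbrs E2 A V"
      using 1 2 by (auto simp: nbrs_def)
    moreover have "y \<notin> nbrs E2 A V" "finite (nbrs E2 A V)" using insert by (auto simp: nbrs_def)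
    ultimately show ?thesis by auto
  qed
  have int1: "(\<integral>\<^sup>+E1. ennreal (exp (if E1 = {} then 0 else g y)) \<partial>random_edges (cross A {y}) p)
      = ennreal (1 + ?q * (exp (g y) - 1))"
  proof -
    let ?M = "random_edges (cross A {y}) p"
    have pr: "measure_pmf.prob ?M {{}} = (1 - p) ^ card A"
      using prob_random_edges_empty[of "cross A {y}" p] assms card_cross_singleton[OF yA] by simp
    have prc: "measure_pmf.prob ?M (- {{}}) = ?q"
      using measure_pmf.prob_compl[of "{{}}" ?M] pr by (simp add: Compl_eq_Diff_UNIV)
    have "(\<integral>\<^sup>+E1. ennreal (exp (if E1 = {} then 0 else g y)) \<partial>?M) =
      (\<integral>\<^sup>+E1. 1 * indicator {{}} E1 + ennreal (exp (g y)) * indicator (- {{}}) E1 \<partial>?M)"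
      by (intro nn_integral_cong) (auto simp: indicator_def)
    also have "\<dots> = emeasure ?M {{}} + ennreal (exp (g y)) * emeasure ?M (- {{}})"
      by (subst nn_integral_add) (auto simp: nn_integral_cmult)
    also have "\<dots> = ennreal ((1 - p) ^ card A + exp (g y) * ?q)"
      using q assms by (simp add: measure_pmf.emeasure_eq_measure pr prc ennreal_plus ennreal_mult')
    also have "(1 - p) ^ card A + exp (g y) * ?q = 1 + ?q * (exp (g y) - 1)" by (simp add: algebra_simps)
    finally show ?thesis .
  qed
  have "(\<integral>\<^sup>+E. ennreal (exp (\<Sum>z\<in>nbrs E A (insert y V). g z)) \<partial>random_edges (cross A (insert y V)) p)
    = (\<integral>\<^sup>+x. ennreal (exp (\<Sum>z\<in>nbrs (fst x \<union> snd x) A (insert y V). g z))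
         \<partial>pair_pmf (random_edges (cross A {y}) p) (random_edges (cross A V) p))"
    unfolding eq using random_edges_Un[OF _ _ disj, of p] insert assms by (simp add: split_beta)
  also have "\<dots> = (\<integral>\<^sup>+x. ennreal (exp (if fst x = {} then 0 else g y)) *
         ennreal (exp (\<Sum>z\<in>nbrs (snd x) A V. g z))
         \<partial>pair_pmf (random_edges (cross A {y}) p) (random_edges (cross A V) p))"
  proof (intro nn_integral_cong_AE AE_pmfI)
    fix x assume "x \<in> set_pmf (pair_pmf (random_edges (cross A {y}) p) (random_edges (cross A V) p))"
    then have "fst x \<subseteq> cross A {y}" "snd x \<subseteq> cross A V"
      using set_random_edges[of "cross A {y}" "fst x" p] set_random_edges[of "cross A V" "snd x" p]
        insert assms by auto
    from split[OF this] show "ennreal (exp (\<Sum>z\<in>nbrs (fst x \<union> snd x) A (insert y V). g z)) =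
      ennreal (exp (if fst x = {} then 0 else g y)) * ennreal (exp (\<Sum>z\<in>nbrs (snd x) A V. g z))"
      by (simp add: exp_add ennreal_mult)
  qed
  also have "\<dots> = (\<integral>\<^sup>+E1. ennreal (exp (if E1 = {} then 0 else g y)) \<partial>random_edges (cross A {y}) p) *
      (\<integral>\<^sup>+E2. ennreal (exp (\<Sum>z\<in>nbrs E2 A V. g z)) \<partial>random_edges (cross A V) p)"
    by (simp add: nn_integral_pair_pmf' nn_integral_cmult nn_integral_multc)
  also have "\<dots> = ennreal ((1 + ?q * (exp (g y) - 1)) * (\<Prod>y\<in>V. 1 + ?q * (exp (g y) - 1)))"
    unfolding int1 insert.IH[OF AV] by (rule ennreal_mult[symmetric]) (auto intro!: fac prod_nonneg)
  finally show ?case using insert by simp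
qed

text \<open>A Chernoff bound: both tails and weighted sums are covered by the sign and size of \<open>g\<close>.\<close>

lemma prob_nbrs_tail:
  assumes "finite A" "finite V" "A \<inter> V = {}" "0 \<le> p" "p \<le> 1"
  shows "measure_pmf.prob (random_edges (cross A V) p) {E. t \<le> (\<Sum>y\<in>nbrs E A V. g y)}
    \<le> exp ((\<Sum>y\<in>V. (1 - (1 - p) ^ card A) * (exp (g y) - 1)) - t)"
proof -
  let ?M = "random_edges (cross A V) p" and ?q = "1 - (1 - p) ^ card A"
  have q: "0 \<le> ?q" "?q \<le> 1" using assms(4,5) by (auto intro: power_le_one)
  have fac: "0 \<le> 1 + ?q * (exp (g z) - 1)" for z
  proof -
    have "- 1 \<le> ?q * (- 1)" using q by simp
    also have "\<dots> \<le> ?q * (exp (g z) - 1)" by (rule mult_left_mono) (use q in auto)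
    finally show ?thesis by simp
  qed
  have "emeasure ?M {E. t \<le> (\<Sum>y\<in>nbrs E A V. g y)} =
      (\<integral>\<^sup>+E. indicator {E. t \<le> (\<Sum>y\<in>nbrs E A V. g y)} E \<partial>?M)" by simp
  \<comment> \<open>Markov's inequality for the exponential; the usual free parameter is absorbed
    into \<open>g\<close>.\<close>
  also have "\<dots> \<le> (\<integral>\<^sup>+E. ennreal (exp (- t)) * ennreal (exp (\<Sum>y\<in>nbrs E A V. g y)) \<partial>?M)"
    by (intro nn_integral_mono)
      (auto simp: indicator_def ennreal_mult[symmetric] exp_add[symmetric] simp del: ennreal_1
        simp flip: ennreal_1)
  also have "\<dots> = ennreal (exp (- t) * (\<Prod>y\<in>V. 1 + ?q * (exp (g y) - 1)))"
    by (simp add: nn_integral_cmult nn_integral_exp_nbrs[OF assms] ennreal_mult prod_nonneg fac)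
  finally have "measure_pmf.prob ?M {E. t \<le> (\<Sum>y\<in>nbrs E A V. g y)}
      \<le> exp (- t) * (\<Prod>y\<in>V. 1 + ?q * (exp (g y) - 1))"
    by (simp add: measure_pmf.emeasure_eq_measure prod_nonneg fac)
  also have "\<dots> \<le> exp (- t) * (\<Prod>y\<in>V. exp (?q * (exp (g y) - 1)))"
    by (intro mult_left_mono prod_mono conjI fac) (auto intro: exp_ge_add_one_self)
  also have "\<dots> = exp ((\<Sum>y\<in>V. ?q * (exp (g y) - 1)) - t)"
    by (simp add: exp_sum[OF assms(2)] exp_diff exp_minus field_simps)
  finally show ?thesis .
qed

section \<open>Concentration of layer sizes\<close>

definition pairs_within :: "nat set \<Rightarrow> edges" where
  "pairs_within V = {(a, b). a \<in> V \<and> b \<in> V \<and> a < b}"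

text \<open>A union bound for two-stage exposure: the second estimate is required only for good
  outcomes of the first stage.\<close>

lemma prob_pair_pmf_le:
  assumes "measure_pmf.prob M {x. P x} \<le> a"
    and "\<And>x. x \<in> set_pmf M \<Longrightarrow> \<not> P x \<Longrightarrow> measure_pmf.prob N {y. R x y} \<le> b" and "0 \<le> b"
  shows "measure_pmf.prob (pair_pmf M N) {z. P (fst z) \<or> R (fst z) (snd z)} \<le> a + b"
proof -
  have a: "0 \<le> a" using assms(1) measure_nonneg[of "measure_pmf M" "{x. P x}"] by linarith
  have "emeasure (pair_pmf M N) {z. P (fst z) \<or> R (fst z) (snd z)}
      = (\<integral>\<^sup>+z. indicator {z. P (fst z) \<or> R (fst z) (snd z)} z \<partial>pair_pmf M N)" by simp
  also have "\<dots> = (\<integral>\<^sup>+x. (\<integral>\<^sup>+y. indicator {z. P (fst z) \<or> R (fst z) (snd z)} (x, y) \<partial>N) \<partial>M)"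
    by (rule nn_integral_pair_pmf')
  also have "\<dots> \<le> (\<integral>\<^sup>+x. indicator {x. P x} x + ennreal b \<partial>M)"
  proof (intro nn_integral_mono_AE AE_pmfI)
    fix x assume x: "x \<in> set_pmf M"
    show "(\<integral>\<^sup>+y. indicator {z. P (fst z) \<or> R (fst z) (snd z)} (x, y) \<partial>N) \<le> indicator {x. P x} x + ennreal b"
    proof (cases "P x")
      case True
      have "(\<integral>\<^sup>+y. indicator {z. P (fst z) \<or> R (fst z) (snd z)} (x, y) \<partial>N) \<le> (\<integral>\<^sup>+y. 1 \<partial>N)"
        by (intro nn_integral_mono) (auto simp: indicator_def)
      then show ?thesis using True by (simp add: add_increasing2)
    next
      case False
      have "(\<integral>\<^sup>+y. indicator {z. P (fst z) \<or> R (fst z) (snd z)} (x, y) \<partial>N) = (\<integral>\<^sup>+y. indicator {y. R x y} y \<partial>N)"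
        using False by (intro nn_integral_cong) (auto simp: indicator_def)
      also have "\<dots> = ennreal (measure_pmf.prob N {y. R x y})"
        by (simp add: measure_pmf.emeasure_eq_measure)
      finally show ?thesis using assms(2)[OF x False] False by (simp add: ennreal_leI)
    qed
  qed
  also have "\<dots> = ennreal (measure_pmf.prob M {x. P x}) + ennreal b"
    by (subst nn_integral_add) (auto simp: measure_pmf.emeasure_eq_measure)
  also have "\<dots> \<le> ennreal (a + b)" using assms a by (simp add: ennreal_plus ennreal_leI)
  finally show ?thesis using a assms(3)
    by (simp add: measure_pmf.emeasure_eq_measure del: ennreal_plus)
qed

text \<open>Expose \<open>Q1\<close> first and the rest afterwards. The conjunct
  \<open>E2 <= Q - Q1\<close> (as sets) holds almost surely; having it inside the event lets the
  second-stage bound use that the new edges avoid \<open>Q1\<close>.\<close>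

lemma prob_random_edges_split:
  assumes "finite Q" "Q1 \<subseteq> Q" "measure_pmf.prob (random_edges Q1 p) {E. P E} \<le> a"
    and "\<And>E1. E1 \<subseteq> Q1 \<Longrightarrow> \<not> P E1 \<Longrightarrow>
      measure_pmf.prob (random_edges (Q - Q1) p) {E2. E2 \<subseteq> Q - Q1 \<and> R (E1 \<union> E2)} \<le> b" and "0 \<le> b"
  shows "measure_pmf.prob (random_edges Q p) {E. P (E \<inter> Q1) \<or> R E} \<le> a + b"
proof -
  have fin: "finite Q1" "finite (Q - Q1)" using assms(1,2) by (auto intro: finite_subset)
  have Q: "Q1 \<union> (Q - Q1) = Q" using assms(2) by auto
  let ?M = "pair_pmf (random_edges Q1 p) (random_edges (Q - Q1) p)"
  have "measure_pmf.prob (random_edges Q p) {E. P (E \<inter> Q1) \<or> R E} =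
      measure_pmf.prob ?M {z. P ((fst z \<union> snd z) \<inter> Q1) \<or> R (fst z \<union> snd z)}"
    using random_edges_Un[OF fin, of p] unfolding Q by (simp add: vimage_def split_beta)
  also have "\<dots> \<le> measure_pmf.prob ?M
      {z. P (fst z) \<or> snd z \<subseteq> Q - Q1 \<and> R (fst z \<union> snd z)}"
  proof (rule measure_pmf.finite_measure_mono_AE)
    show "AE z in ?M. z \<in> {z. P ((fst z \<union> snd z) \<inter> Q1) \<or> R (fst z \<union> snd z)} \<longrightarrow>
      z \<in> {z. P (fst z) \<or> snd z \<subseteq> Q - Q1 \<and> R (fst z \<union> snd z)}"
    proof (intro AE_pmfI impI)
      fix z assume z: "z \<in> set_pmf ?M" "z \<in> {z. P ((fst z \<union> snd z) \<inter> Q1) \<or> R (fst z \<union> snd z)}"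
      have sub: "fst z \<subseteq> Q1" "snd z \<subseteq> Q - Q1"
        using z(1) set_random_edges[OF fin(1), of "fst z" p] set_random_edges[OF fin(2), of "snd z" p] by auto
      then have "(fst z \<union> snd z) \<inter> Q1 = fst z" by auto
      with z(2) sub show "z \<in> {z. P (fst z) \<or> snd z \<subseteq> Q - Q1 \<and> R (fst z \<union> snd z)}" by auto
    qed
  qed auto
  also have "\<dots> \<le> a + b"
    by (rule prob_pair_pmf_le[OF assms(3)])
      (use assms(4,5) set_random_edges[OF fin(1)] in auto)
  finally show ?thesis .
qed

section \<open>Locality of layers and two elementary estimates\<close>

lemma layer_cong:
  assumes "\<And>x y. x \<in> A \<union> V \<Longrightarrow> y \<in> V \<Longrightarrow> adj E x y = adj E' x y"
  shows "layer E k A V = layer E' k A V"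
  using assms
proof (induction k arbitrary: A V)
  case (Suc k)
  have eq: "nbrs E A V = nbrs E' A V" using Suc.prems by (auto simp: nbrs_def)
  have "layer E k (nbrs E' A V) (V - nbrs E' A V) = layer E' k (nbrs E' A V) (V - nbrs E' A V)"
    by (rule Suc.IH) (use Suc.prems in \<open>auto simp: nbrs_def\<close>)
  then show ?case using eq by simp
qed simp

lemma nbrs_subset: "nbrs E A V \<subseteq> V" by (auto simp: nbrs_def)

text \<open>The right side times \<open>1 + x + x^2/2\<close>, a lower bound of
  \<open>exp x\<close>, equals \<open>1 + x^4/4\<close>, hence is at least 1.\<close>

lemma exp_minus_le_quadratic:
  fixes x :: real assumes "0 \<le> x" shows "exp (- x) \<le> 1 - x + x\<^sup>2 / 2"
proof -
  have pos: "0 < 1 - x + x\<^sup>2 / 2"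
  proof -
    have "0 \<le> (x - 1)\<^sup>2" by simp
    then show ?thesis by (simp add: power2_eq_square algebra_simps)
  qed
  have "1 \<le> 1 + x ^ 4 / 4" by simp
  also have "\<dots> = (1 + x + x\<^sup>2 / 2) * (1 - x + x\<^sup>2 / 2)"
    by (simp add: power2_eq_square power4_eq_xxxx field_simps)
  also have "\<dots> \<le> exp x * (1 - x + x\<^sup>2 / 2)"
    using exp_lower_Taylor_quadratic[OF assms] pos by (intro mult_right_mono) auto
  finally show ?thesis by (simp add: exp_minus field_simps)
qed

text \<open>The probability that a vertex has a neighbour in a set of size \<open>a\<close> is
  \<open>p * a\<close> up to a second-order loss for multiple hits.\<close>

lemma one_minus_power_le:
  fixes p :: real assumes "0 \<le> p" "p \<le> 1"
  shows "1 - (1 - p) ^ a \<le> p * a" "p * a * (1 - p * a / 2) \<le> 1 - (1 - p) ^ a"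
proof -
  show "1 - (1 - p) ^ a \<le> p * a"
    using Bernoulli_inequality[of "- p" a] assms by (simp add: mult.commute)
  have "(1 - p) ^ a \<le> exp (- p) ^ a"
    using assms exp_ge_add_one_self[of "- p"] by (intro power_mono) auto
  also have "\<dots> = exp (- (p * a))" by (simp add: exp_of_nat_mult[symmetric] mult.commute)
  also have "\<dots> \<le> 1 - p * a + (p * a)\<^sup>2 / 2" using assms by (intro exp_minus_le_quadratic) auto
  finally show "p * a * (1 - p * a / 2) \<le> 1 - (1 - p) ^ a"
    by (simp add: power2_eq_square algebra_simps)
qed

text \<open>Here \<open>D\<close> is the expected degree and \<open>J\<close> a radius at which balls still fill only a small
  fraction of the graph. The band \<open>[L i, U i]\<close> for the size of the \<open>i\<close>-th layer widens by a
  summable relative amount at every level, so it stays within a constant factor of \<open>D ^ i\<close>; the term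
  \<open>6 * D ^ i / n\<close> pays for the already explored vertices and for multiple hits.\<close>

locale layered =
  fixes n J :: nat and p D :: real
  assumes p: "0 \<le> p" "p \<le> 1" and D: "D = real n * p" and D_ge: "2000 * ln (real n) \<le> D"
    and ln_n: "1 \<le> ln (real n)" and D_J: "D ^ J \<le> real n / 1000"
begin

definition U :: "nat \<Rightarrow> real" where "U i = D ^ i * (2 - (1 / 2) ^ i)"
definition L :: "nat \<Rightarrow> real" where "L i = D ^ i * (3 / 4 + (1 / 2) ^ i / 4 - 6 * D ^ i / real n)"

lemma D_2000: "2000 \<le> D" using D_ge ln_n by linarith

lemma n_pos: "0 < real n" using ln_n by (cases "n = 0") auto

lemma D_power_le: "i \<le> J \<Longrightarrow> D ^ i \<le> real n / 1000"
  using D_J power_increasing[of i J D] D_2000 by linarith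

lemma U_bounds: "0 \<le> U i" "U i \<le> 2 * D ^ i" and D_pos: "0 < D ^ i"
proof -
  show "0 < D ^ i" using D_2000 by simp
  moreover have "(1 / 2 :: real) ^ i \<le> 1" by (simp add: power_le_one)
  ultimately show "0 \<le> U i" "U i \<le> 2 * D ^ i" unfolding U_def
    by (auto intro!: mult_nonneg_nonneg)
qed

text \<open>The bounds grow by a factor of about \<open>D >= 2000\<close>, so a ball is no larger in
  order than its outermost sphere.\<close>

lemma sum_U_le: "(\<Sum>j\<le>i. U j) \<le> 3 * D ^ i"
proof (induction i)
  case 0 then show ?case by (simp add: U_def)
next
  case (Suc i)
  have "3 * D ^ i + 2 * D ^ Suc i \<le> 3 * D ^ Suc i" using D_2000 D_pos[of i] by simp
  then show ?case using Suc U_bounds(2)[of "Suc i"] by simp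
qed

lemma L_ge: "i \<le> J \<Longrightarrow> D ^ i / 2 \<le> L i"
proof -
  assume "i \<le> J"
  then have "6 * D ^ i / real n \<le> 6 / 1000" using D_power_le[of i] n_pos by (simp add: field_simps)
  then have "1 / 2 \<le> 3 / 4 + (1 / 2) ^ i / 4 - 6 * D ^ i / real n"
    using zero_le_power[of "1/2::real" i] by linarith
  then have "D ^ i * (1 / 2) \<le> L i" unfolding L_def using D_pos[of i] by (intro mult_left_mono) auto
  then show ?thesis by simp
qed

text \<open>The relative slack halves at each level, which costs a factor 4 in the Chernoff
  exponent, but the mean gains a factor \<open>D >= 4\<close>. The exponent therefore never falls
  below order \<open>D\<close>.\<close>

lemma D_power_half: "D \<le> D ^ Suc i * ((1 / 2) ^ i)\<^sup>2"
proof -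
  have "1 \<le> (D / 4) ^ i" using D_2000 by (intro one_le_power) auto
  then have "D * 1 \<le> D * (D / 4) ^ i" using D_2000 by (intro mult_left_mono) auto
  also have "((1 / 2 :: real) ^ i)\<^sup>2 = (1 / 4) ^ i"
    by (simp add: power2_eq_square flip: power_mult_distrib)
  then have "D * (D / 4) ^ i = D ^ Suc i * ((1 / 2) ^ i)\<^sup>2" by (simp add: power_divide)
  finally show ?thesis by simp
qed

text \<open>The density hypothesis is spent here: 2000/128 exceeds 3. The cube leaves O(1/n) after a
  union bound over \<open>n\<close> roots and at most \<open>n\<close> levels; 128 is the
  denominator produced by \<open>lower_step\<close>.\<close>

lemma exp_neg_D_le: "D / 128 \<le> x \<Longrightarrow> exp (- x) \<le> 1 / real n ^ 3"
proof -
  assume "D / 128 \<le> x"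
  then have "exp (- x) \<le> exp (- (3 * ln (real n)))" using D_ge ln_n by simp
  also have "\<dots> = 1 / real n ^ 3"
    using n_pos exp_of_nat_mult[of 3 "ln (real n)"] by (simp add: exp_minus inverse_eq_divide)
  finally show ?thesis .
qed

text \<open>With \<open>h = (1/2)^i\<close> the mean is at most
  \<open>D * U i = D^(i+1) * (2 - h)\<close>, while the threshold is
  \<open>D^(i+1) * (2 - h/2)\<close>: a relative gap of order \<open>h\<close> is available.\<close>

lemma upper_step:
  assumes "finite A" "finite V" "A \<inter> V = {}" "card A \<le> U i" "card V \<le> n"
  shows "measure_pmf.prob (random_edges (cross A V) p) {E. U (Suc i) < card (nbrs E A V)} \<le> 1 / real n ^ 3"
proof -
  define h :: real where "h = (1 / 2) ^ i"
  \<comment> \<open>The minimiser of \<open>2 * t^2 - t * h / 2\<close>, with value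
    \<open>- h^2 / 32\<close>.\<close>
  define t where "t = h / 8"
  have h: "0 < h" "h \<le> 1" by (auto simp: h_def power_le_one)
  have t: "0 < t" "t \<le> 1" using h by (auto simp: t_def)
  let ?q = "1 - (1 - p) ^ card A"
  have q: "0 \<le> ?q" "?q \<le> p * card A" using p one_minus_power_le(1)[OF p] by (auto intro: power_le_one)
  have e: "0 \<le> exp t - 1" "exp t - 1 \<le> t + t\<^sup>2" using t exp_bound[of t] by auto
  have "(\<Sum>y\<in>V. ?q * (exp t - 1)) = card V * ?q * (exp t - 1)" by simp
  also have "\<dots> \<le> (real n * (p * U i)) * (t + t\<^sup>2)"
  proof (rule mult_mono[OF _ e(2)])
    have "p * card A \<le> p * U i" using assms(4) p by (intro mult_left_mono) auto
    then show "card V * ?q \<le> real n * (p * U i)" using q assms(5) by (intro mult_mono) auto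
  qed (use e p U_bounds in auto)
  also have "\<dots> = D ^ Suc i * (2 - h) * (t + t\<^sup>2)"
    by (subst mult.assoc[symmetric], subst D[symmetric]) (simp add: U_def h_def)
  finally have "(\<Sum>y\<in>V. ?q * (exp t - 1)) - t * U (Suc i)
      \<le> D ^ Suc i * (2 - h) * (t + t\<^sup>2) - t * (D ^ Suc i * (2 - h / 2))"
    by (simp add: U_def h_def)
  also have "\<dots> = D ^ Suc i * ((2 - h) * t\<^sup>2 - t * h / 2)" by (simp add: algebra_simps)
  also have "\<dots> \<le> D ^ Suc i * (- (h\<^sup>2 / 32))"
  proof (rule mult_left_mono)
    have "(2 - h) * t\<^sup>2 \<le> 2 * t\<^sup>2" using h by (intro mult_right_mono) auto
    moreover have "2 * t\<^sup>2 - t * h / 2 \<le> - (h\<^sup>2 / 32)" by (simp add: t_def power2_eq_square)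
    ultimately show "(2 - h) * t\<^sup>2 - t * h / 2 \<le> - (h\<^sup>2 / 32)" by linarith
  qed (use D_pos[of "Suc i"] in auto)
  finally have ex: "(\<Sum>y\<in>V. ?q * (exp t - 1)) - t * U (Suc i) \<le> - (D ^ Suc i * h\<^sup>2 / 32)" by simp
  have "measure_pmf.prob (random_edges (cross A V) p) {E. U (Suc i) < card (nbrs E A V)}
    \<le> measure_pmf.prob (random_edges (cross A V) p) {E. t * U (Suc i) \<le> (\<Sum>y\<in>nbrs E A V. t)}"
    using t by (intro measure_pmf.finite_measure_mono) (auto simp: mult.commute intro!: mult_left_mono)
  also have "\<dots> \<le> exp ((\<Sum>y\<in>V. ?q * (exp t - 1)) - t * U (Suc i))"
    by (rule prob_nbrs_tail) (use assms p in auto)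
  also have "\<dots> \<le> exp (- (D ^ Suc i * h\<^sup>2 / 32))" using ex by simp
  also have "\<dots> \<le> 1 / real n ^ 3"
    by (rule exp_neg_D_le) (use D_power_half[of i] D_2000 in \<open>simp add: h_def\<close>)
  finally show ?thesis .
qed

text \<open>The mean falls short of \<open>D * L i\<close> for two reasons, explored vertices
  missing from \<open>V\<close> and vertices hit more than once. Both losses are relative errors of
  order \<open>D^(i+1) / n\<close>, which the third term of \<open>L\<close> absorbs.\<close>

lemma lower_step:
  assumes "finite A" "finite V" "A \<inter> V = {}" "L i \<le> card A" "card A \<le> U i"
    and V: "real n - 2 - (\<Sum>j\<le>i. U j) \<le> card V" and i: "Suc i \<le> J"
  shows "measure_pmf.prob (random_edges (cross A V) p) {E. card (nbrs E A V) < L (Suc i)} \<le> 1 / real n ^ 3"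
proof -
  define h :: real where "h = (1 / 2) ^ i"
  \<comment> \<open>The minimiser of \<open>t^2 / 2 - t * h / 8\<close>, with value
    \<open>- h^2 / 128\<close>.\<close>
  define t where "t = h / 8"
  \<comment> \<open>One bound for both relative losses: the fraction of vertices already explored
    and the collision term \<open>p * card A / 2\<close>.\<close>
  define x where "x = D ^ Suc i / real n"
  define l where "l = 3 / 4 + h / 4 - 6 * D ^ i / real n"
  have h: "0 < h" "h \<le> 1" by (auto simp: h_def power_le_one)
  have t: "0 < t" "t \<le> 1" using h by (auto simp: t_def)
  have x: "0 \<le> x" "x \<le> 1 / 1000"
    using D_power_le[OF i] n_pos D_pos[of "Suc i"] by (auto simp: x_def field_simps)
  let ?q = "1 - (1 - p) ^ card A"
  have pA: "p * card A / 2 \<le> x"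
  proof -
    have "p * card A \<le> p * (2 * D ^ i)" using assms(5) U_bounds(2)[of i] p by (intro mult_left_mono) auto
    then show ?thesis using n_pos by (simp add: x_def D field_simps)
  qed
  have q: "p * card A * (1 - x) \<le> ?q"
  proof -
    have "p * card A * (1 - x) \<le> p * card A * (1 - p * card A / 2)"
      using pA p by (intro mult_left_mono) auto
    then show ?thesis using one_minus_power_le(2)[OF p, of "card A"] by linarith
  qed
  have cV: "real n * (1 - x) \<le> card V"
  proof -
    have "2 + 3 * D ^ i \<le> D ^ Suc i"
      using D_2000 one_le_power[of D i] D_pos[of i] mult_right_mono[of 5 D "D ^ i"]
      unfolding power_Suc by linarith
    then have "real n - D ^ Suc i \<le> card V" using V sum_U_le[of i] by linarith
    then show ?thesis using n_pos by (simp add: x_def algebra_simps)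
  qed
  have L_i: "L i = D ^ i * l" by (simp add: L_def l_def h_def)
  have l: "3 * x \<le> l" "l \<le> 1"
  proof -
    have "D ^ i / 2 \<le> D ^ i * l" using L_ge[of i] i L_i by simp
    then have "1 / 2 \<le> l" using D_pos[of i] by simp
    then show "3 * x \<le> l" using x by simp
    have "0 \<le> D ^ i / real n" using D_pos[of i] n_pos by simp
    then show "l \<le> 1" using h by (simp add: l_def)
  qed
  have M: "D ^ Suc i * (l - 3 * x) \<le> card V * ?q"
  proof -
    have "D ^ Suc i * (l - 3 * x) \<le> D ^ Suc i * (l * ((1 - x) * (1 - x)))"
    proof (rule mult_left_mono)
      have "l * (1 - 2 * x) \<le> l * ((1 - x) * (1 - x))"
        using l x by (intro mult_left_mono) (auto simp: algebra_simps)
      moreover have "l * x \<le> 1 * x" using l x by (intro mult_right_mono) auto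
      ultimately show "l - 3 * x \<le> l * ((1 - x) * (1 - x))" using x by (simp add: algebra_simps)
    qed (use D_pos[of "Suc i"] in auto)
    also have "\<dots> = (real n * (1 - x)) * (p * L i * (1 - x))" unfolding L_i by (simp add: D)
    also have "\<dots> \<le> card V * (p * card A * (1 - x))"
      using cV x p assms(4) L_i D_pos[of i] l by (intro mult_mono mult_nonneg_nonneg) auto
    also have "\<dots> \<le> card V * ?q" using q by (intro mult_left_mono) auto
    finally show ?thesis .
  qed
  have e: "exp (- t) - 1 \<le> - (t - t\<^sup>2 / 2)" "0 \<le> t - t\<^sup>2 / 2"
    using exp_minus_le_quadratic[of t] t mult_left_mono[of t 1 t] by (auto simp: power2_eq_square)
  have q0: "0 \<le> card V * ?q" using p
    by (intro mult_nonneg_nonneg) (auto intro: power_le_one)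
  have "(\<Sum>y\<in>V. ?q * (exp (- t) - 1)) = card V * ?q * (exp (- t) - 1)" by simp
  also have "\<dots> \<le> card V * ?q * (- (t - t\<^sup>2 / 2))" by (rule mult_left_mono[OF e(1) q0])
  also have "\<dots> \<le> (D ^ Suc i * (l - 3 * x)) * (- (t - t\<^sup>2 / 2))"
    using mult_right_mono[OF M e(2)] by linarith
  also have "\<dots> + t * L (Suc i) \<le> - (D ^ Suc i * h\<^sup>2 / 128)"
  proof -
    \<comment> \<open>The origin of the 6 in \<open>L\<close>: the correction inherited from level
      \<open>i\<close> uses at most half of the new \<open>6 * x\<close>, and the other half pays
      for the losses at this level.\<close>
    have dx: "6 * D ^ i / real n \<le> 3 * x"
      using n_pos D_2000 D_pos[of i] by (simp add: x_def field_simps)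
    have "L (Suc i) = D ^ Suc i * (3 / 4 + h / 8 - 6 * x)" by (simp add: L_def h_def x_def)
    also have "\<dots> \<le> D ^ Suc i * (l - 3 * x - h / 8)"
      using D_pos[of "Suc i"] dx by (intro mult_left_mono) (auto simp: l_def)
    finally have "t * L (Suc i) \<le> t * (D ^ Suc i * (l - 3 * x - h / 8))"
      using t by (intro mult_left_mono) auto
    then have "(D ^ Suc i * (l - 3 * x)) * (- (t - t\<^sup>2 / 2)) + t * L (Suc i)
      \<le> D ^ Suc i * ((l - 3 * x) * (t\<^sup>2 / 2) - t * h / 8)" by (simp add: algebra_simps)
    also have "\<dots> \<le> D ^ Suc i * (1 * (t\<^sup>2 / 2) - t * h / 8)"
      using D_pos[of "Suc i"] l x by (intro mult_left_mono diff_right_mono mult_right_mono) auto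
    also have "\<dots> = - (D ^ Suc i * h\<^sup>2 / 128)" by (simp add: t_def power2_eq_square)
    finally show ?thesis .
  qed
  finally have ex: "(\<Sum>y\<in>V. ?q * (exp (- t) - 1)) - (- t * L (Suc i)) \<le> - (D ^ Suc i * h\<^sup>2 / 128)"
    by simp
  have "measure_pmf.prob (random_edges (cross A V) p) {E. card (nbrs E A V) < L (Suc i)}
    \<le> measure_pmf.prob (random_edges (cross A V) p) {E. - t * L (Suc i) \<le> (\<Sum>y\<in>nbrs E A V. - t)}"
    using t by (intro measure_pmf.finite_measure_mono) (auto simp: mult.commute intro!: mult_left_mono)
  also have "\<dots> \<le> exp ((\<Sum>y\<in>V. ?q * (exp (- t) - 1)) - (- t * L (Suc i)))"
    by (rule prob_nbrs_tail) (use assms p in auto)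
  also have "\<dots> \<le> exp (- (D ^ Suc i * h\<^sup>2 / 128))" using ex by simp
  also have "\<dots> \<le> 1 / real n ^ 3"
    by (rule exp_neg_D_le) (use D_power_half[of i] in \<open>simp add: h_def\<close>)
  finally show ?thesis .
qed

text \<open>The starting level and the pair set \<open>Q\<close> are arbitrary so that the induction
  can restart: one round exposes \<open>cross A V\<close>, fixes \<open>F = nbrs E A V\<close>, and
  continues from \<open>F\<close> in \<open>V - F\<close> with the unexposed pairs. Each round costs
  one upper and one lower tail.\<close>

lemma layers_concentrate_aux:
  assumes "finite Q" "cross A V \<union> pairs_within V \<subseteq> Q" "finite A" "finite V" "A \<inter> V = {}"
    and "L i \<le> card A" "card A \<le> U i" "real n - 2 - (\<Sum>j\<le>i. U j) \<le> card V" "card V \<le> n" "i + k \<le> J"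
  shows "measure_pmf.prob (random_edges Q p)
    {E. \<exists>j\<le>k. \<not> (L (i + j) \<le> card (layer E j A V) \<and> card (layer E j A V) \<le> U (i + j))}
    \<le> real k * (2 / real n ^ 3)"
  using assms
proof (induction k arbitrary: i A V Q)
  case 0
  then show ?case by simp
next
  case (Suc k)
  let ?ok = "\<lambda>j S. L j \<le> card S \<and> card S \<le> U j"
  let ?P = "\<lambda>E. \<not> ?ok (Suc i) (nbrs E A V)"
  let ?R = "\<lambda>E. ?ok (Suc i) (nbrs E A V) \<and>
    (\<exists>j\<le>k. \<not> ?ok (Suc i + j) (layer E j (nbrs E A V) (V - nbrs E A V)))"
  let ?Q1 = "cross A V"
  have nbrs_restrict: "nbrs (E \<inter> ?Q1) A V = nbrs E A V" for E
    by (auto simp: nbrs_def adj_def mem_cross_iff)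
  have "measure_pmf.prob (random_edges Q p)
      {E. \<exists>j\<le>Suc k. \<not> ?ok (i + j) (layer E j A V)}
    \<le> measure_pmf.prob (random_edges Q p) {E. ?P (E \<inter> ?Q1) \<or> ?R E}"
  proof (intro measure_pmf.finite_measure_mono subsetI)
    fix E assume "E \<in> {E. \<exists>j\<le>Suc k. \<not> ?ok (i + j) (layer E j A V)}"
    then obtain j where j: "j \<le> Suc k" "\<not> ?ok (i + j) (layer E j A V)" by auto
    then obtain j' where "j = Suc j'" using Suc.prems by (cases j) auto
    with j show "E \<in> {E. ?P (E \<inter> ?Q1) \<or> ?R E}" by (auto simp: nbrs_restrict)
  qed auto
  also have "\<dots> \<le> 2 / real n ^ 3 + real k * (2 / real n ^ 3)"
  proof (rule prob_random_edges_split)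
    show "finite Q" "?Q1 \<subseteq> Q" using Suc.prems by auto
    have "measure_pmf.prob (random_edges ?Q1 p) {E. ?P E} \<le>
      measure_pmf.prob (random_edges ?Q1 p)
        ({E. card (nbrs E A V) < L (Suc i)} \<union> {E. U (Suc i) < card (nbrs E A V)})"
      by (intro measure_pmf.finite_measure_mono) auto
    also have "\<dots> \<le> 1 / real n ^ 3 + 1 / real n ^ 3"
    proof (rule order.trans[OF measure_Un_le add_mono])
      show "measure_pmf.prob (random_edges ?Q1 p) {E. card (nbrs E A V) < L (Suc i)} \<le> 1 / real n ^ 3"
        by (rule lower_step) (use Suc.prems in auto)
      show "measure_pmf.prob (random_edges ?Q1 p) {E. U (Suc i) < card (nbrs E A V)} \<le> 1 / real n ^ 3"
        by (rule upper_step) (use Suc.prems in auto)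
    qed auto
    finally show "measure_pmf.prob (random_edges ?Q1 p) {E. ?P E} \<le> 2 / real n ^ 3" by simp
    show "0 \<le> real k * (2 / real n ^ 3)" by simp
    fix E1 assume E1: "E1 \<subseteq> ?Q1" "\<not> ?P E1"
    define F where "F = nbrs E1 A V"
    have FV: "F \<subseteq> V" by (auto simp: F_def nbrs_def)
    have ok: "?ok (Suc i) F" using E1(2) by (simp add: F_def)
    have "measure_pmf.prob (random_edges (Q - ?Q1) p) {E2. E2 \<subseteq> Q - ?Q1 \<and> ?R (E1 \<union> E2)}
      \<le> measure_pmf.prob (random_edges (Q - ?Q1) p) {E2. \<exists>j\<le>k. \<not> ?ok (Suc i + j) (layer E2 j F (V - F))}"
    proof (intro measure_pmf.finite_measure_mono subsetI)
      fix E2 assume "E2 \<in> {E2. E2 \<subseteq> Q - ?Q1 \<and> ?R (E1 \<union> E2)}"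
      then have E2: "E2 \<subseteq> Q - ?Q1" "?R (E1 \<union> E2)" by auto
      have F: "nbrs (E1 \<union> E2) A V = F"
        unfolding F_def using nbrs_restrict[of "E1 \<union> E2"] nbrs_restrict[of E1] E1(1) E2(1)
        by (metis Diff_disjoint Int_Un_distrib2 Int_absorb2 Int_commute Un_empty_right disjoint_iff subset_iff)
      have "layer (E1 \<union> E2) j F (V - F) = layer E2 j F (V - F)" for j
      proof (rule layer_cong)
        fix x y assume "x \<in> F \<union> (V - F)" "y \<in> V - F"
        then have "(min x y, max x y) \<notin> ?Q1" using FV Suc.prems(5) by (auto simp: mem_cross_iff)
        then show "adj (E1 \<union> E2) x y = adj E2 x y" using E1(1) by (auto simp: adj_def)
      qed
      with E2(2) show "E2 \<in> {E2. \<exists>j\<le>k. \<not> ?ok (Suc i + j) (layer E2 j F (V - F))}"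
        unfolding F by auto
    qed auto
    also have "\<dots> \<le> real k * (2 / real n ^ 3)"
    proof (rule Suc.IH)
      \<comment> \<open>Pairs inside \<open>V\<close> are untouched by the first exposure, and the
        next round reads only such pairs.\<close>
      have "e \<in> Q - ?Q1" if "e \<in> pairs_within V" for e
      proof -
        obtain a b where ab: "e = (a, b)" "a \<in> V" "b \<in> V" "a < b" using \<open>e \<in> pairs_within V\<close> by (auto simp: pairs_within_def)
        have "(a, b) \<notin> ?Q1"
          using mem_cross_iff[of a b A V] ab Suc.prems(5) by (auto simp: min_def max_def)
        then show ?thesis using ab that Suc.prems(2) by auto
      qed
      moreover have "(min a b, max a b) \<in> pairs_within V" if "a \<in> F" "b \<in> V - F" for a b
        using that FV by (cases a b rule: linorder_cases) (auto simp: pairs_within_def)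
      then have "cross F (V - F) \<union> pairs_within (V - F) \<subseteq> pairs_within V"
        by (auto simp: cross_def pairs_within_def)
      ultimately show "cross F (V - F) \<union> pairs_within (V - F) \<subseteq> Q - ?Q1" by auto
      show "finite (Q - ?Q1)" "finite (V - F)" "F \<inter> (V - F) = {}" "Suc i + k \<le> J"
        using Suc.prems by auto
      show finF: "finite F" using FV Suc.prems finite_subset by auto
      show "L (Suc i) \<le> card F" "card F \<le> U (Suc i)" using ok by auto
      have c: "real (card (V - F)) = real (card V) - real (card F)"
        using FV finF Suc.prems by (simp add: card_Diff_subset card_mono of_nat_diff)
      show "real n - 2 - (\<Sum>j\<le>Suc i. U j) \<le> card (V - F)" using c ok Suc.prems by simp
      show "card (V - F) \<le> n" using card_Diff_subset[OF finF FV] Suc.prems by simp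
    qed
    finally show "measure_pmf.prob (random_edges (Q - ?Q1) p) {E2. E2 \<subseteq> Q - ?Q1 \<and> ?R (E1 \<union> E2)}
      \<le> real k * (2 / real n ^ 3)" .
  qed
  also have "\<dots> = real (Suc k) * (2 / real n ^ 3)" by (simp add: algebra_simps add_divide_distrib)
  finally show ?case .
qed

definition layers_ok :: "edges \<Rightarrow> nat \<Rightarrow> nat set \<Rightarrow> bool" where
  "layers_ok E x V \<longleftrightarrow> (\<forall>j\<le>J. L j \<le> card (layer E j {x} V) \<and> card (layer E j {x} V) \<le> U j)"

text \<open>The slack of 3 covers the case where \<open>u\<close>, \<open>v\<close> and the root
  itself are removed: the root is counted by \<open>U 0 = 1\<close> and the other two by the 2 in
  the hypothesis on \<open>card V\<close> of the induction.\<close>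

lemma layers_concentrate:
  assumes "finite Q" "cross {x} V \<union> pairs_within V \<subseteq> Q" "finite V" "x \<notin> V" "n \<le> card V + 3" "card V \<le> n"
  shows "measure_pmf.prob (random_edges Q p) {E. \<not> layers_ok E x V} \<le> real J * (2 / real n ^ 3)"
proof -
  have "{E. \<not> layers_ok E x V} = {E. \<exists>j\<le>J. \<not> (L (0 + j) \<le> card (layer E j {x} V) \<and> card (layer E j {x} V) \<le> U (0 + j))}"
    by (auto simp: layers_ok_def)
  also have "measure_pmf.prob (random_edges Q p) \<dots> \<le> real J * (2 / real n ^ 3)"
    by (rule layers_concentrate_aux) (use assms n_pos in \<open>auto simp: L_def U_def\<close>)
  finally show ?thesis .
qed

end

section \<open>Layers and distances\<close>

definition adj_on :: "edges \<Rightarrow> nat set \<Rightarrow> (nat \<times> nat) set" where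
  "adj_on E W = {(a, b). a \<in> W \<and> b \<in> W \<and> adj E a b}"

text \<open>The condition \<open>y : W\<close> matters at distance 0, where the relation power is
  the identity and would admit a centre outside \<open>W\<close>.\<close>

definition ball_on :: "edges \<Rightarrow> nat set \<Rightarrow> nat \<Rightarrow> nat \<Rightarrow> nat set" where
  "ball_on E W k x = {y \<in> W. \<exists>j\<le>k. (x, y) \<in> adj_on E W ^^ j}"

lemma adj_on_mono: "W \<subseteq> W' \<Longrightarrow> (x, y) \<in> adj_on E W ^^ k \<Longrightarrow> (x, y) \<in> adj_on E W' ^^ k"
  unfolding relpow_fun_conv adj_on_def by blast

lemma adj_on_sym: "(x, y) \<in> adj_on E W ^^ k \<Longrightarrow> (y, x) \<in> adj_on E W ^^ k"
proof (induction k arbitrary: y)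
  case (Suc k)
  then obtain z where "(x, z) \<in> adj_on E W ^^ k" "(z, y) \<in> adj_on E W" by auto
  then have "(z, x) \<in> adj_on E W ^^ k" "(y, z) \<in> adj_on E W"
    using Suc.IH by (auto simp: adj_on_def adj_sym)
  then show ?case by (metis relpow_Suc_I2)
qed auto

lemma ball_on_sym: "x \<in> W \<Longrightarrow> y \<in> W \<Longrightarrow> y \<in> ball_on E W k x \<longleftrightarrow> x \<in> ball_on E W k y"
  using adj_on_sym by (auto simp: ball_on_def)

text \<open>Peeling off \<open>A\<close> turns the universe of \<open>A\<close> and \<open>V\<close>
  into \<open>V\<close> alone, so a neighbour outside \<open>A\<close> is covered by the induction
  hypothesis for the next root set.\<close>

lemma layer_closed:
  assumes "z \<in> layer E i A V" "y \<in> A \<union> V" "adj E z y"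
  shows "\<exists>i'\<le>Suc i. y \<in> layer E i' A V"
  using assms
proof (induction i arbitrary: A V)
  case 0
  show ?case
  proof (cases "y \<in> A")
    case True
    then show ?thesis by (intro exI[of _ 0]) auto
  next
    case False
    then have "y \<in> layer E (Suc 0) A V" using 0 by (auto simp: nbrs_def)
    then show ?thesis by blast
  qed
next
  case (Suc i)
  let ?F = "nbrs E A V"
  show ?case
  proof (cases "y \<in> A")
    case True
    then show ?thesis by (intro exI[of _ 0]) auto
  next
    case False
    then have "\<exists>i'\<le>Suc i. y \<in> layer E i' ?F (V - ?F)" using Suc by (intro Suc.IH) auto
    then obtain i' where "i' \<le> Suc i" "y \<in> layer E (Suc i') A V" by auto
    then show ?thesis by (intro exI[of _ "Suc i'"]) auto
  qed
qed

lemma reachable_imp_layer: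
  assumes "a \<in> A" "(a, y) \<in> adj_on E (A \<union> V) ^^ j"
  shows "\<exists>i\<le>j. y \<in> layer E i A V"
  using assms(2)
proof (induction j arbitrary: y)
  case 0
  then show ?case using assms(1) by auto
next
  case (Suc j)
  then obtain z where z: "(a, z) \<in> adj_on E (A \<union> V) ^^ j" "(z, y) \<in> adj_on E (A \<union> V)" by auto
  then obtain i where i: "i \<le> j" "z \<in> layer E i A V" using Suc.IH by blast
  have "\<exists>i'\<le>Suc i. y \<in> layer E i' A V"
    by (rule layer_closed[OF i(2)]) (use z(2) in \<open>auto simp: adj_on_def\<close>)
  then show ?case using i(1) by (meson Suc_le_mono le_trans)
qed

text \<open>After its first step the path stays in \<open>V\<close>. Hence the sphere around
  \<open>u\<close> is covered by balls around neighbours of \<open>u\<close>, measured in a graph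
  that does not contain \<open>u\<close>.\<close>

lemma layer_imp_reachable:
  assumes "y \<in> layer E (Suc k) A V"
  shows "\<exists>x\<in>nbrs E A V. (x, y) \<in> adj_on E V ^^ k"
  using assms
proof (induction k arbitrary: A V)
  case 0
  then show ?case by auto
next
  case (Suc k)
  let ?F = "nbrs E A V"
  have "y \<in> layer E (Suc k) ?F (V - ?F)" using Suc.prems by simp
  then obtain x' where x': "x' \<in> nbrs E ?F (V - ?F)" "(x', y) \<in> adj_on E (V - ?F) ^^ k"
    using Suc.IH by blast
  then obtain x where x: "x \<in> ?F" "adj E x x'" by (auto simp: nbrs_def)
  have "(x, x') \<in> adj_on E V" using x x'(1) by (auto simp: nbrs_def adj_on_def)
  moreover have "(x', y) \<in> adj_on E V ^^ k" by (rule adj_on_mono[OF _ x'(2)]) auto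
  ultimately have "(x, y) \<in> adj_on E V ^^ Suc k" by (metis relpow_Suc_I2)
  then show ?case using x by blast
qed

lemma layer_subset: "layer E (Suc k) A V \<subseteq> V"
proof
  fix y assume y: "y \<in> layer E (Suc k) A V"
  then obtain x where x: "x \<in> nbrs E A V" "(x, y) \<in> adj_on E V ^^ k" using layer_imp_reachable by blast
  show "y \<in> V"
  proof (cases k)
    case 0
    then show ?thesis using x by (auto simp: nbrs_def)
  next
    case (Suc k')
    then show ?thesis using x by (auto simp: adj_on_def)
  qed
qed

section \<open>Walks, graph distance and splitting vertices\<close>

lemma walk_iff: "walk E u v k \<longleftrightarrow> (u, v) \<in> adj_on E UNIV ^^ k"
proof
  assume "walk E u v k"
  then obtain xs where "length xs = Suc k" "xs ! 0 = u" "xs ! k = v" "\<forall>i<k. adj E (xs ! i) (xs ! Suc i)"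
    by (auto simp: walk_def)
  then show "(u, v) \<in> adj_on E UNIV ^^ k"
    unfolding relpow_fun_conv by (intro exI[of _ "\<lambda>i. xs ! i"]) (auto simp: adj_on_def)
next
  assume "(u, v) \<in> adj_on E UNIV ^^ k"
  then obtain f where f: "f 0 = u" "f k = v" "\<forall>i<k. (f i, f (Suc i)) \<in> adj_on E UNIV"
    unfolding relpow_fun_conv by auto
  show "walk E u v k" unfolding walk_def
    by (rule exI[of _ "map f [0..<Suc k]"]) (use f in \<open>auto simp: adj_on_def nth_append simp del: upt_Suc\<close>)
qed

lemma gdist_le: "walk E u v k \<Longrightarrow> gdist E u v \<le> enat k"
  by (auto simp: gdist_def intro: Least_le)

lemma le_gdist: "(\<And>k. walk E u v k \<Longrightarrow> d \<le> enat k) \<Longrightarrow> d \<le> gdist E u v"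
  by (auto simp: gdist_def intro: LeastI)

lemma gdist_cases:
  obtains (finite) k where "walk E u v k" "gdist E u v = enat k" | (infinite) "gdist E u v = \<infinity>"
  by (cases "\<exists>k. walk E u v k") (auto simp: gdist_def intro: LeastI that)

lemma gdist_adj_le:
  assumes "adj E u v" shows "gdist E s v \<le> gdist E s u + 1"
proof (cases rule: gdist_cases[of E s u])
  case (finite k)
  then have "walk E s v (Suc k)" using assms by (auto simp: walk_iff adj_on_def)
  then show ?thesis using finite gdist_le[of E s v "Suc k"] by (simp add: one_enat_def)
qed auto

lemma gdist_eq_1_iff: "u \<noteq> v \<Longrightarrow> gdist E u v = 1 \<longleftrightarrow> adj E u v"
proof
  assume "u \<noteq> v" "adj E u v"
  then have "walk E u v 1" by (auto simp: walk_iff adj_on_def)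
  moreover have "1 \<le> k" if "walk E u v k" for k using that \<open>u \<noteq> v\<close> by (cases k) (auto simp: walk_iff)
  ultimately show "gdist E u v = 1"
    by (intro antisym) (auto simp: one_enat_def intro!: gdist_le le_gdist)
next
  assume "u \<noteq> v" "gdist E u v = 1"
  then show "adj E u v"
    by (cases rule: gdist_cases[of E u v]) (auto simp: walk_iff adj_on_def one_enat_def)
qed

text \<open>A shortest path from \<open>s\<close> to \<open>v\<close> either passes through \<open>u\<close>, and then needs two more steps, or
  lives in the graph without \<open>u\<close>, in which \<open>s\<close> is far from \<open>v\<close>.\<close>

lemma layer_separates:
  assumes E: "E \<subseteq> vpairs n" and uv: "u \<noteq> v" "u < n" "v < n" "\<not> adj E u v"
    and V: "V = {..<n} - {u, v}" and s: "s \<in> layer E (Suc j) {u} V"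
    and far: "\<And>i. i \<le> j + 2 \<Longrightarrow> s \<notin> layer E i {v} V"
  shows "gdist E s u + 1 < gdist E s v"
proof -
  have sV: "s \<in> V" using s layer_subset by blast
  obtain x where x: "x \<in> nbrs E {u} V" "(x, s) \<in> adj_on E V ^^ j" using layer_imp_reachable[OF s] by blast
  have "(u, x) \<in> adj_on E UNIV" using x by (auto simp: nbrs_def adj_on_def)
  moreover have "(x, s) \<in> adj_on E UNIV ^^ j" by (rule adj_on_mono[OF _ x(2)]) auto
  ultimately have "(u, s) \<in> adj_on E UNIV ^^ Suc j" by (metis relpow_Suc_I2)
  then have "walk E s u (Suc j)" unfolding walk_iff by (rule adj_on_sym)
  then have du: "gdist E s u \<le> enat (Suc j)" by (rule gdist_le)
  have "gdist E s u + 2 \<le> gdist E s v"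
  proof (rule le_gdist)
    fix k assume "walk E s v k"
    then obtain f where f: "f 0 = s" "f k = v" "\<And>i. i < k \<Longrightarrow> adj E (f i) (f (Suc i))"
      unfolding walk_iff relpow_fun_conv by (auto simp: adj_on_def)
    show "gdist E s u + 2 \<le> enat k"
    proof (cases "\<exists>i\<le>k. f i = u")
      case True
      then obtain i where i: "i \<le> k" "f i = u" by auto
      have "walk E s u i"
        unfolding walk_iff relpow_fun_conv using f i by (intro exI[of _ f]) (auto simp: adj_on_def)
      then have "gdist E s u \<le> enat i" by (rule gdist_le)
      moreover have "i + 2 \<le> k"
      proof (rule ccontr)
        assume "\<not> i + 2 \<le> k"
        then have "k = i \<or> k = Suc i" using i(1) by auto
        then show False using f(2) f(3)[of i] i uv by auto
      qed
      ultimately show ?thesis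
        by (metis add_right_mono enat_ord_simps(1) numeral_eq_enat order_trans plus_enat_simps(1))
    next
      case False
      have inW: "f i \<in> {v} \<union> V" if "i \<le> k" for i
      proof (cases "i = k")
        case True
        then show ?thesis using f by simp
      next
        case ne: False
        then have "adj E (f i) (f (Suc i))" using f(3) that by simp
        then have "f i < n" using E by (auto simp: adj_def vpairs_def min_def max_def split: if_splits)
        then show ?thesis using False that V by auto
      qed
      have "(s, v) \<in> adj_on E ({v} \<union> V) ^^ k"
        unfolding relpow_fun_conv using f inW by (intro exI[of _ f]) (auto simp: adj_on_def)
      then have "(v, s) \<in> adj_on E ({v} \<union> V) ^^ k" by (rule adj_on_sym)
      then obtain i where "i \<le> k" "s \<in> layer E i {v} V" using reachable_imp_layer[of v "{v}"] by blast
      \<comment> \<open>A path avoiding \<open>u\<close> has length at least \<open>j + 3\<close>,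
        while \<open>u\<close> is within \<open>j + 1\<close> of \<open>s\<close>: exactly the gap
        of two that is required.\<close>
      then have "j + 3 \<le> k" using far[of i] by (cases "i \<le> j + 2") auto
      moreover obtain d where "gdist E s u = enat d" "d \<le> Suc j" using du by (cases "gdist E s u") auto
      ultimately show ?thesis by (simp add: numeral_eq_enat)
    qed
  qed
\<comment> \<open>Passing from \<open>+ 2\<close> to a strict inequality needs a finite distance to
  \<open>u\<close>, which \<open>du\<close> supplies.\<close>
then show ?thesis
    using du by (cases "gdist E s u"; cases "gdist E s v") (auto simp: numeral_eq_enat one_enat_def)
qed

section \<open>The reconstruction strategy\<close>

text \<open>Additions on both sides replace the absolute difference, so that infinite distances need
  no special treatment.\<close>

definition unsplit :: "nat list \<Rightarrow> (nat \<Rightarrow> nat \<Rightarrow> enat) \<Rightarrow> nat \<Rightarrow> nat \<Rightarrow> bool" where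
  "unsplit ss d u v \<longleftrightarrow> (\<forall>s\<in>set ss. d s u \<le> d s v + 1 \<and> d s v \<le> d s u + 1)"

definition candidates :: "nat \<Rightarrow> nat list \<Rightarrow> (nat \<Rightarrow> nat \<Rightarrow> enat) \<Rightarrow> (nat \<times> nat) list" where
  "candidates n ss d = filter (\<lambda>(u, v). u < v \<and> unsplit ss d u v) (List.product [0..<n] [0..<n])"

definition answer :: "history \<Rightarrow> nat \<Rightarrow> nat \<Rightarrow> enat" where
  "answer h a b = the (map_of h (a, b))"

text \<open>The second list is recomputed from the history at every call. Before all seed answers
  are present it may be meaningless, but then the current position still falls into
  \<open>q1\<close>, so the query does not depend on it.\<close>

definition seed_strategy :: "nat \<Rightarrow> nat list \<Rightarrow> strategy" where
  "seed_strategy n ss h =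
    (let q1 = List.product ss [0..<n]; q2 = candidates n ss (answer (take (length q1) h)); q = q1 @ q2
     in if length h < length q then Query (fst (q ! length h)) (snd (q ! length h))
        else Output {(u, v) \<in> set q2. answer h u v = 1})"

lemma answer_map:
  "(a, b) \<in> set q \<Longrightarrow> answer (map (\<lambda>x. (x, gdist E (fst x) (snd x))) q) a b = gdist E a b"
  by (simp add: answer_def map_of_map_restrict)

context
  fixes n :: nat and ss :: "nat list" and E :: edges
begin

private abbreviation "q1 \<equiv> List.product ss [0..<n]"
private abbreviation "q \<equiv> q1 @ candidates n ss (gdist E)"
private abbreviation "record \<equiv> map (\<lambda>x. (x, gdist E (fst x) (snd x)))"

private lemma candidates_record:
  assumes "length q1 \<le> k"
  shows "candidates n ss (answer (take (length q1) (record (take k q)))) = candidates n ss (gdist E)"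
proof -
  have "take (length q1) (record (take k q)) = record q1"
    using assms by (simp add: take_map min_def)
  moreover have "answer (record q1) s u = gdist E s u" if "s \<in> set ss" "u < n" for s u
    using that by (intro answer_map) auto
  ultimately show ?thesis unfolding candidates_def unsplit_def
    by (intro filter_cong) auto
qed

private lemma seed_act:
  "seed_strategy n ss (record (take k q)) =
    (if k < length q then Query (fst (q ! k)) (snd (q ! k))
     else Output {(u, v) \<in> set (candidates n ss (gdist E)). gdist E u v = 1})"
proof (cases "k < length q1")
  case True
  then show ?thesis by (simp add: seed_strategy_def Let_def nth_append)
next
  case False
  then have c: "candidates n ss (answer (take (length q1) (record (take k q)))) = candidates n ss (gdist E)"
    by (intro candidates_record) simp
  show ?thesis
  proof (cases "k < length q")
    case True
    then have "length (record (take k q)) = k" by simp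
    then show ?thesis using True unfolding seed_strategy_def Let_def c by simp
  next
    case False
    then have "take k q = q" by simp
    moreover have "{(u, v) \<in> set (candidates n ss (gdist E)). answer (record q) u v = 1} =
        {(u, v) \<in> set (candidates n ss (gdist E)). gdist E u v = 1}"
      using answer_map[of _ _ q E] by auto
    moreover have "\<not> length (record (take k q)) < length q" using False by simp
    ultimately show ?thesis using False unfolding seed_strategy_def Let_def c by simp
  qed
qed

text \<open>On a fixed graph the adaptive strategy just runs through the fixed list
  \<open>q\<close>; its query count and output can be read off from this list.\<close>

private lemma transcript_seed: "transcript (seed_strategy n ss) E k = record (take k q)"
proof (induction k)
  case 0
  then show ?case by simp
next
  case (Suc k)
  show ?case
  proof (cases "k < length q")
    case True
    then have "record (take (Suc k) q) = record (take k q) @ [(q ! k, gdist E (fst (q ! k)) (snd (q ! k)))]"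
      by (simp only: take_Suc_conv_app_nth map_append list.map)
    then show ?thesis using True by (simp only: transcript.simps Suc seed_act Let_def if_True action.case prod.collapse)
  next
    case False
    then have "take (Suc k) q = q" "take k q = q" by simp_all
    then have "take (Suc k) q = take k q" by (simp only:)
    then show ?thesis using False by (simp only: transcript.simps Suc seed_act Let_def if_False action.case)
  qed
qed

lemma num_queries_seed:
  "num_queries (seed_strategy n ss) E = enat (length ss * n + card {(u, v) \<in> vpairs n. unsplit ss (gdist E) u v})"
proof -
  have halted: "halted (seed_strategy n ss) E k \<longleftrightarrow> length q \<le> k" for k
    unfolding halted_def transcript_seed seed_act by (simp add: not_less)
  have least: "(LEAST k. halted (seed_strategy n ss) E k) = length q"
    unfolding halted by (rule Least_equality) (rule order.refl)
  have ex: "\<exists>k. halted (seed_strategy n ss) E k" unfolding halted by blast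
  have "num_queries (seed_strategy n ss) E = enat (length q)"
    unfolding num_queries_def least using ex by (rule if_P)
  moreover have "length (candidates n ss (gdist E)) = card (set (candidates n ss (gdist E)))"
    by (rule distinct_card[symmetric]) (auto simp: candidates_def distinct_product)
  moreover have "set (candidates n ss (gdist E)) = {(u, v) \<in> vpairs n. unsplit ss (gdist E) u v}"
    by (auto simp: candidates_def vpairs_def)
  ultimately show ?thesis by simp
qed

text \<open>Distances to adjacent vertices differ by at most one, so no edge is ever filtered out,
  and distance 1 identifies the edges among the candidates. No property of the seeds enters.\<close>

lemma reconstructs_seed:
  assumes E: "E \<subseteq> vpairs n"
  shows "reconstructs (seed_strategy n ss) E"
proof -
  have "{(u, v) \<in> set (candidates n ss (gdist E)). gdist E u v = 1} = E"
  proof (intro set_eqI, clarify)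
    fix u v
    show "((u, v) \<in> {(u, v) \<in> set (candidates n ss (gdist E)). gdist E u v = 1}) = ((u, v) \<in> E)"
    proof (cases "u < v \<and> v < n")
      case True
      then have "adj E u v \<longleftrightarrow> (u, v) \<in> E" by (auto simp: adj_def)
      moreover have "unsplit ss (gdist E) u v" if "adj E u v"
        using gdist_adj_le[OF that] gdist_adj_le[of E v u] that by (auto simp: unsplit_def adj_sym)
      ultimately show ?thesis using True gdist_eq_1_iff[of u v E] by (auto simp: candidates_def)
    next
      case False
      then show ?thesis using E by (auto simp: candidates_def vpairs_def)
    qed
  qed
  then have "seed_strategy n ss (transcript (seed_strategy n ss) E (length q)) = Output E"
    unfolding transcript_seed seed_act by simp
  then show ?thesis unfolding reconstructs_def by blast
qed

end

section \<open>Pairs with few separating vertices\<close>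

lemma layer_cong_subset:
  assumes "E1 \<subseteq> E" "\<And>a b. (a, b) \<in> E - E1 \<Longrightarrow> a \<notin> A \<union> V \<or> b \<notin> A \<union> V"
  shows "layer E k A V = layer E1 k A V"
  by (rule layer_cong) (use assms in \<open>fastforce simp: adj_def min_def max_def split: if_splits\<close>)

lemma ball_on_cong:
  assumes "E1 \<subseteq> E" "\<And>a b. (a, b) \<in> E - E1 \<Longrightarrow> a \<notin> W \<or> b \<notin> W"
  shows "ball_on E W k x = ball_on E1 W k x"
proof -
  have "adj_on E W = adj_on E1 W"
    using assms by (fastforce simp: adj_on_def adj_def min_def max_def split: if_splits)
  then show ?thesis by (simp add: ball_on_def)
qed

text \<open>Double counting of pairs at distance at most \<open>k\<close>, by symmetry of
  reachability. It turns overlaps with \<open>Z\<close>, summed over all centres, into plain ball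
  sizes.\<close>

lemma sum_card_ball_on:
  assumes "finite W" "Z \<subseteq> W"
  shows "(\<Sum>x\<in>W. card (ball_on E W k x \<inter> Z)) = (\<Sum>z\<in>Z. card (ball_on E W k z))"
proof -
  have finZ: "finite Z" using assms finite_subset by auto
  have "(\<Sum>x\<in>W. card (ball_on E W k x \<inter> Z)) = (\<Sum>x\<in>W. \<Sum>z\<in>Z. if z \<in> ball_on E W k x then 1 else 0)"
    using finZ by (intro sum.cong refl) (simp add: sum.If_cases Int_commute)
  also have "\<dots> = (\<Sum>z\<in>Z. \<Sum>x\<in>W. if x \<in> ball_on E W k z then 1 else 0)"
    using assms by (subst sum.swap) (intro sum.cong refl, auto simp: ball_on_sym subset_iff)
  also have "\<dots> = (\<Sum>z\<in>Z. card (ball_on E W k z))"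
  proof (intro sum.cong refl)
    fix z
    have "W \<inter> {x. x \<in> ball_on E W k z} = ball_on E W k z" by (auto simp: ball_on_def)
    then show "(\<Sum>x\<in>W. if x \<in> ball_on E W k z then 1 else 0) = card (ball_on E W k z)"
      using assms by (simp add: sum.If_cases)
  qed
  finally show ?thesis .
qed

lemma prob_replicate_avoid:
  "measure_pmf.prob (replicate_pmf m M) {xs. set xs \<inter> T = {}} = (measure_pmf.prob M (- T)) ^ m"
  for M :: "'a :: countable pmf"
proof (induction m)
  case 0
  then show ?case by (simp add: measure_return_pmf)
next
  case (Suc m)
  have "replicate_pmf (Suc m) M = map_pmf (\<lambda>(x, xs). x # xs) (pair_pmf M (replicate_pmf m M))"
    by (simp add: pair_pmf_def map_bind_pmf map_return_pmf)
  then have "measure_pmf.prob (replicate_pmf (Suc m) M) {xs. set xs \<inter> T = {}} =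
      measure_pmf.prob (pair_pmf M (replicate_pmf m M)) ((\<lambda>(x, xs). x # xs) -` {xs. set xs \<inter> T = {}})"
    by simp
  also have "(\<lambda>(x, xs). x # xs) -` {xs. set xs \<inter> T = {}} = (- T) \<times> {xs. set xs \<inter> T = {}}" by auto
  also have "measure_pmf.prob (pair_pmf M (replicate_pmf m M)) \<dots> =
      measure_pmf.prob M (- T) * measure_pmf.prob (replicate_pmf m M) {xs. set xs \<inter> T = {}}"
    by (rule measure_pmf_prob_product) auto
  finally show ?case using Suc by simp
qed

section \<open>Overlap of the two balls and the number of splitting vertices\<close>

context layered
begin

lemma card_ball_on_le:
  assumes "finite W" "x \<in> W" "layers_ok E x (W - {x})" "k \<le> J"
  shows "card (ball_on E W k x) \<le> 3 * D ^ k"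
proof -
  have fin: "finite (layer E j {x} (W - {x}))" for j
    using layer_subset[of E _ "{x}" "W - {x}"] assms(1)
    by (cases j) (auto intro: finite_subset)
  have "ball_on E W k x \<subseteq> (\<Union>j\<le>k. layer E j {x} (W - {x}))"
  proof
    fix y assume "y \<in> ball_on E W k x"
    then obtain j where j: "j \<le> k" "(x, y) \<in> adj_on E ({x} \<union> (W - {x})) ^^ j"
      using assms(2) by (auto simp: ball_on_def insert_absorb)
    then show "y \<in> (\<Union>j\<le>k. layer E j {x} (W - {x}))"
      using reachable_imp_layer[of x "{x}" y j E "W - {x}"] by fastforce
  qed
  then have "card (ball_on E W k x) \<le> card (\<Union>j\<le>k. layer E j {x} (W - {x}))"
    using fin by (intro card_mono) auto
  also have "\<dots> \<le> (\<Sum>j\<le>k. card (layer E j {x} (W - {x})))" by (rule card_UN_le) simp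
  finally have "real (card (ball_on E W k x)) \<le> (\<Sum>j\<le>k. real (card (layer E j {x} (W - {x}))))"
    by (simp flip: of_nat_sum)
  also have "\<dots> \<le> (\<Sum>j\<le>k. U j)" using assms by (intro sum_mono) (auto simp: layers_ok_def)
  also have "\<dots> \<le> 3 * D ^ k" by (rule sum_U_le)
  finally show ?thesis .
qed

text \<open>The ball of radius \<open>J\<close> around \<open>v\<close>; with \<open>V\<close>
  lacking \<open>u\<close> and \<open>v\<close> it lives in the graph without
  \<open>u\<close>.\<close>

definition explored :: "edges \<Rightarrow> nat \<Rightarrow> nat set \<Rightarrow> nat set" where
  "explored E v V = (\<Union>i\<le>J. layer E i {v} V)"

lemma card_explored_le:
  assumes "layers_ok E v V"
  shows "card (explored E v V) \<le> 3 * D ^ J"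
proof -
  have "card (explored E v V) \<le> (\<Sum>i\<le>J. card (layer E i {v} V))"
    unfolding explored_def by (rule card_UN_le) simp
  then have "real (card (explored E v V)) \<le> (\<Sum>i\<le>J. real (card (layer E i {v} V)))"
    by (simp flip: of_nat_sum)
  also have "\<dots> \<le> (\<Sum>i\<le>J. U i)" using assms by (intro sum_mono) (auto simp: layers_ok_def)
  also have "\<dots> \<le> 3 * D ^ J" by (rule sum_U_le)
  finally show ?thesis .
qed

text \<open>The neighbours of \<open>u\<close> are chosen independently of the ball around \<open>v\<close> in the graph without
  \<open>u\<close>, so the balls around them rarely meet it.\<close>

lemma overlap_tail:
  assumes J: "J = k + 2" and fin: "finite V" "u \<notin> V" "v \<notin> V"
    and v: "layers_ok E v V" and V: "\<And>x. x \<in> V \<Longrightarrow> layers_ok E x (V - {x})"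
  shows "measure_pmf.prob (random_edges (cross {u} V) p)
      {F. D ^ (k + 1) / 4 \<le> (\<Sum>x\<in>nbrs F {u} V. card (ball_on E V k x \<inter> explored E v V))} \<le> 1 / real n ^ 3"
proof -
  define Z where "Z = explored E v V \<inter> V"
  have Z: "ball_on E V k x \<inter> explored E v V = ball_on E V k x \<inter> Z" for x
    by (auto simp: Z_def ball_on_def)
  \<comment> \<open>Dividing by the maximal ball size gives weights in [0,1], for which
    \<open>exp g - 1 <= 2 * g\<close>. By double counting they sum to at most
    \<open>card Z <= 3 * n / 1000\<close>, so the exponential-moment term is at most
    \<open>6 * D / 1000\<close>, far below the rescaled threshold \<open>D / 12\<close>.\<close>
  define b where "b = 3 * D ^ k"
  define g where "g = (\<lambda>x. real (card (ball_on E V k x \<inter> Z)) / b)"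
  have b: "0 < b" using D_pos by (simp add: b_def)
  have finball: "finite (ball_on E V k x)" for x using fin by (simp add: ball_on_def)
  have ball: "card (ball_on E V k x) \<le> b" if "x \<in> V" for x
    unfolding b_def using V that fin J by (intro card_ball_on_le) auto
  have g: "0 \<le> g x" "g x \<le> 1" if "x \<in> V" for x
  proof -
    have "card (ball_on E V k x \<inter> Z) \<le> card (ball_on E V k x)" using finball by (intro card_mono) auto
    then show "0 \<le> g x" "g x \<le> 1" using ball[OF that] b by (auto simp: g_def)
  qed
  have Zle: "card Z \<le> 3 * D ^ J"
  proof -
    have "finite (explored E v V)"
      unfolding explored_def
    proof (intro finite_UN_I)
      fix i show "finite (layer E i {v} V)"
        using layer_subset[of E _ "{v}" V] fin by (cases i) (auto intro: finite_subset)
    qed auto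
    then have "card Z \<le> card (explored E v V)" by (auto simp: Z_def intro: card_mono)
    then show ?thesis using card_explored_le[OF v] by linarith
  qed
  have "(\<Sum>x\<in>V. real (card (ball_on E V k x \<inter> Z))) = (\<Sum>z\<in>Z. real (card (ball_on E V k z)))"
    using sum_card_ball_on[of V Z E k] fin by (simp add: Z_def flip: of_nat_sum)
  also have "\<dots> \<le> (\<Sum>z\<in>Z. b)" using ball by (intro sum_mono) (auto simp: Z_def)
  finally have sumg: "(\<Sum>x\<in>V. g x) \<le> card Z" using b by (simp add: g_def field_simps flip: sum_divide_distrib)
  have "(\<Sum>x\<in>V. (1 - (1 - p) ^ card {u}) * (exp (g x) - 1)) \<le> (\<Sum>x\<in>V. p * (2 * g x))"
  proof (intro sum_mono)
    fix x assume x: "x \<in> V"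
    have "exp (g x) \<le> 1 + g x + (g x)\<^sup>2" using g[OF x] by (intro exp_bound) auto
    also have "(g x)\<^sup>2 \<le> g x * 1" unfolding power2_eq_square using g[OF x] by (intro mult_left_mono) auto
    finally show "(1 - (1 - p) ^ card {u}) * (exp (g x) - 1) \<le> p * (2 * g x)"
      using p by (auto intro: mult_left_mono)
  qed
  also have "\<dots> = 2 * p * (\<Sum>x\<in>V. g x)" unfolding sum_distrib_left by (simp add: mult_ac)
  also have "\<dots> \<le> 2 * p * (3 * (real n / 1000))"
    using sumg Zle D_J p by (intro mult_left_mono) auto
  also have "\<dots> = 6 * D / 1000" by (simp add: D)
  finally have ex: "(\<Sum>x\<in>V. (1 - (1 - p) ^ card {u}) * (exp (g x) - 1)) - D / 12 \<le> - (D / 128)"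
    using D_2000 by simp
  have scale: "D ^ (k + 1) / 4 / b = D / 12" using D_pos[of k] D_2000 by (simp add: b_def)
  have "measure_pmf.prob (random_edges (cross {u} V) p)
      {F. D ^ (k + 1) / 4 \<le> (\<Sum>x\<in>nbrs F {u} V. card (ball_on E V k x \<inter> explored E v V))}
    \<le> measure_pmf.prob (random_edges (cross {u} V) p) {F. D / 12 \<le> (\<Sum>x\<in>nbrs F {u} V. g x)}"
  proof (intro measure_pmf.finite_measure_mono subsetI)
    fix F assume "F \<in> {F. D ^ (k + 1) / 4 \<le> (\<Sum>x\<in>nbrs F {u} V. card (ball_on E V k x \<inter> explored E v V))}"
    then have "D ^ (k + 1) / 4 \<le> (\<Sum>x\<in>nbrs F {u} V. real (card (ball_on E V k x \<inter> Z)))" by (simp add: Z)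
    then have "D ^ (k + 1) / 4 / b \<le> (\<Sum>x\<in>nbrs F {u} V. real (card (ball_on E V k x \<inter> Z))) / b"
      using b by (intro divide_right_mono) auto
    then show "F \<in> {F. D / 12 \<le> (\<Sum>x\<in>nbrs F {u} V. g x)}"
      unfolding scale by (simp add: g_def sum_divide_distrib)
  qed auto
  also have "\<dots> \<le> exp ((\<Sum>x\<in>V. (1 - (1 - p) ^ card {u}) * (exp (g x) - 1)) - D / 12)"
    by (rule prob_nbrs_tail) (use fin p in auto)
  also have "\<dots> \<le> exp (- (D / 128))" using ex by simp
  also have "\<dots> \<le> 1 / real n ^ 3" by (rule exp_neg_D_le) simp
  finally show ?thesis .
qed

text \<open>One-sided: the vertices closer to \<open>u\<close> by at least two, matching an argument
  that grows the sphere around \<open>u\<close>.\<close>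

definition separators :: "edges \<Rightarrow> nat \<Rightarrow> nat \<Rightarrow> nat set" where
  "separators E u v = {s \<in> {..<n}. gdist E s u + 1 < gdist E s v}"

text \<open>The sphere of radius \<open>k + 1\<close> around \<open>u\<close> has at least
  \<open>D^(k+1) / 2\<close> vertices, and outside a rare event fewer than half of that many lie in
  the ball around \<open>v\<close>; the others are separators by
  \<open>layer_separates\<close>.\<close>

lemma few_separators:
  assumes J: "J = k + 2" and uv: "u \<noteq> v" "u < n" "v < n"
  shows "measure_pmf.prob (Gnp n p) {E. \<not> adj E u v \<and> card (separators E u v) < D ^ (k + 1) / 4} \<le> 5 / real n"
proof -
  define V where "V = {..<n} - {u, v}"
  \<comment> \<open>The pairs exposed last. The pair of \<open>u\<close> and \<open>v\<close> itself
    belongs to \<open>Q1\<close>, since \<open>v\<close> is not in \<open>V\<close>.\<close>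
  define Q2 where "Q2 = cross {u} V"
  define Q1 where "Q1 = vpairs n - Q2"
  let ?P = "\<lambda>E. \<not> (layers_ok E v V \<and> (\<forall>x\<in>V. layers_ok E x (V - {x})))"
  let ?R = "\<lambda>E. D ^ (k + 1) / 4 \<le> (\<Sum>x\<in>nbrs E {u} V. card (ball_on E V k x \<inter> explored E v V))"
  let ?c = "real J * (2 / real n ^ 3)"
  have c0: "0 \<le> ?c" by simp
  have V: "finite V" "u \<notin> V" "v \<notin> V" "V \<subseteq> {..<n}" and cardV: "card V + 2 = n"
    using uv by (auto simp: V_def)
  have sub: "cross {w} V \<subseteq> vpairs n" if "w < n" "w \<notin> V" for w
  proof -
    have "(min w y, max w y) \<in> vpairs n" if "y \<in> V" for y
      using that \<open>w < n\<close> \<open>w \<notin> V\<close> V(4) by (cases w y rule: linorder_cases) (auto simp: vpairs_def)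
    then show ?thesis by (auto simp: cross_def)
  qed
  have pairs_within_sub: "pairs_within V \<subseteq> vpairs n" using V(4) by (auto simp: pairs_within_def vpairs_def)
  have Q2_end: "a = u \<or> b = u" if "(a, b) \<in> Q2" for a b
    using that by (auto simp: Q2_def cross_def min_def max_def split: if_splits)
  have v_sub: "cross {v} V \<union> pairs_within V \<subseteq> Q1"
  proof -
    have "a \<noteq> u \<and> b \<noteq> u" if "(a, b) \<in> cross {v} V \<union> pairs_within V" for a b
      using that V uv by (auto simp: cross_def pairs_within_def min_def max_def split: if_splits)
    moreover have "cross {v} V \<union> pairs_within V \<subseteq> vpairs n" using sub[of v] pairs_within_sub uv V by auto
    ultimately show ?thesis using Q2_end unfolding Q1_def by fast
  qed
  have x_sub: "cross {x} (V - {x}) \<union> pairs_within (V - {x}) \<subseteq> Q1" if "x \<in> V" for x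
  proof -
    have "(min x y, max x y) \<in> pairs_within V" if "y \<in> V - {x}" for y
      using that \<open>x \<in> V\<close> by (cases x y rule: linorder_cases) (auto simp: pairs_within_def)
    then have "cross {x} (V - {x}) \<union> pairs_within (V - {x}) \<subseteq> pairs_within V" by (auto simp: cross_def pairs_within_def)
    then show ?thesis using v_sub by auto
  qed
  have fin1: "finite Q1" by (simp add: Q1_def)
  have PQ1: "measure_pmf.prob (random_edges Q1 p) {E. ?P E} \<le> (1 + real (card V)) * ?c"
  proof -
    have "measure_pmf.prob (random_edges Q1 p) {E. ?P E} \<le> measure_pmf.prob (random_edges Q1 p)
        ({E. \<not> layers_ok E v V} \<union> (\<Union>x\<in>V. {E. \<not> layers_ok E x (V - {x})}))"
      by (intro measure_pmf.finite_measure_mono) auto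
    also have "\<dots> \<le> measure_pmf.prob (random_edges Q1 p) {E. \<not> layers_ok E v V} +
        (\<Sum>x\<in>V. measure_pmf.prob (random_edges Q1 p) {E. \<not> layers_ok E x (V - {x})})"
      by (rule order.trans[OF measure_Un_le add_left_mono])
        (auto intro!: measure_pmf.finite_measure_subadditive_finite V)
    also have "\<dots> \<le> ?c + (\<Sum>x\<in>V. ?c)"
    proof (intro add_mono sum_mono)
      show "measure_pmf.prob (random_edges Q1 p) {E. \<not> layers_ok E v V} \<le> ?c"
        by (rule layers_concentrate) (use fin1 v_sub V cardV in auto)
      fix x assume x: "x \<in> V"
      show "measure_pmf.prob (random_edges Q1 p) {E. \<not> layers_ok E x (V - {x})} \<le> ?c"
        by (rule layers_concentrate) (use fin1 x_sub[OF x] V cardV x in \<open>auto simp: card_Diff_singleton\<close>)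
    qed
    also have "\<dots> = (1 + real (card V)) * ?c" unfolding sum_constant by (simp only: distrib_right mult_1_left)
    finally show ?thesis .
  qed
  have PR: "measure_pmf.prob (random_edges (vpairs n) p) {E. ?P (E \<inter> Q1) \<or> ?R E}
      \<le> (1 + real (card V)) * ?c + 1 / real n ^ 3"
  proof (rule prob_random_edges_split[OF _ _ PQ1])
    fix E1 assume E1: "E1 \<subseteq> Q1" "\<not> ?P E1"
    have compl: "vpairs n - Q1 = Q2" using sub[of u] uv V by (auto simp: Q1_def Q2_def)
    have eq: "?R (E1 \<union> E2) \<longleftrightarrow>
        D ^ (k + 1) / 4 \<le> (\<Sum>x\<in>nbrs E2 {u} V. card (ball_on E1 V k x \<inter> explored E1 v V))"
      if E2: "E2 \<subseteq> Q2" for E2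
    proof -
      have out: "a \<notin> {v} \<union> V \<or> b \<notin> {v} \<union> V" if "(a, b) \<in> E1 \<union> E2 - E1" for a b
        using that E2 Q2_end[of a b] V uv by auto
      have "layer (E1 \<union> E2) i {v} V = layer E1 i {v} V" for i
        by (rule layer_cong_subset) (use out in auto)
      then have "explored (E1 \<union> E2) v V = explored E1 v V" by (simp add: explored_def)
      moreover have "ball_on (E1 \<union> E2) V k x = ball_on E1 V k x" for x
        by (rule ball_on_cong) (use out in auto)
      moreover have "nbrs (E1 \<union> E2) {u} V = nbrs E2 {u} V"
      proof -
        have "(min u y, max u y) \<notin> E1" if "y \<in> V" for y
          using that E1 by (auto simp: Q1_def Q2_def mem_cross_iff)
        then show ?thesis by (auto simp: nbrs_def adj_def)
      qed
      ultimately show ?thesis by simp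
    qed
    have "measure_pmf.prob (random_edges (vpairs n - Q1) p) {E2. E2 \<subseteq> vpairs n - Q1 \<and> ?R (E1 \<union> E2)}
      \<le> measure_pmf.prob (random_edges Q2 p)
        {E2. D ^ (k + 1) / 4 \<le> (\<Sum>x\<in>nbrs E2 {u} V. card (ball_on E1 V k x \<inter> explored E1 v V))}"
      unfolding compl
    proof (intro measure_pmf.finite_measure_mono subsetI, unfold mem_Collect_eq)
      fix E2 assume "E2 \<subseteq> Q2 \<and> ?R (E1 \<union> E2)"
      then show "D ^ (k + 1) / 4 \<le> (\<Sum>x\<in>nbrs E2 {u} V. card (ball_on E1 V k x \<inter> explored E1 v V))"
        using eq[of E2] by (simp only:)
    qed simp
    also have "\<dots> \<le> 1 / real n ^ 3"
      unfolding Q2_def by (rule overlap_tail[OF J]) (use V E1 in auto)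
    finally show "measure_pmf.prob (random_edges (vpairs n - Q1) p)
        {E2. E2 \<subseteq> vpairs n - Q1 \<and> ?R (E1 \<union> E2)} \<le> 1 / real n ^ 3" .
  next
    show "finite (vpairs n)" "Q1 \<subseteq> vpairs n" "0 \<le> 1 / real n ^ 3" by (simp_all add: Q1_def)
  qed
  \<comment> \<open>The layers around \<open>u\<close> read edges from both stages, so their sizes
    are bounded over all pairs at once and enter by a union bound instead of by
    conditioning.\<close>
  have Pu: "measure_pmf.prob (random_edges (vpairs n) p) {E. \<not> layers_ok E u V} \<le> ?c"
  proof (rule layers_concentrate)
    show "cross {u} V \<union> pairs_within V \<subseteq> vpairs n" using sub[OF uv(2) V(2)] pairs_within_sub by (rule Un_least)
  qed (use V cardV in simp_all)
  have many: "D ^ (k + 1) / 4 \<le> card (separators E u v)"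
    if E: "E \<subseteq> vpairs n" "\<not> adj E u v" and ok: "layers_ok E u V" "\<not> ?R E" for E
  proof -
    let ?S = "layer E (Suc k) {u} V" and ?Z = "explored E v V"
    have finS: "finite ?S" by (rule finite_subset[OF layer_subset V(1)])
    have "?S \<inter> ?Z \<subseteq> (\<Union>x\<in>nbrs E {u} V. ball_on E V k x \<inter> ?Z)"
    proof
      fix s assume s: "s \<in> ?S \<inter> ?Z"
      then obtain x where x: "x \<in> nbrs E {u} V" "(x, s) \<in> adj_on E V ^^ k"
        using layer_imp_reachable by blast
      moreover have "s \<in> V" using s layer_subset by blast
      ultimately show "s \<in> (\<Union>x\<in>nbrs E {u} V. ball_on E V k x \<inter> ?Z)" using s by (auto simp: ball_on_def)
    qed
    moreover have finN: "finite (nbrs E {u} V)" by (rule finite_subset[OF nbrs_subset V(1)])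
    moreover have "finite (ball_on E V k x)" for x using V(1) by (simp add: ball_on_def)
    ultimately have "card (?S \<inter> ?Z) \<le> card (\<Union>x\<in>nbrs E {u} V. ball_on E V k x \<inter> ?Z)"
      by (intro card_mono) auto
    also have "\<dots> \<le> (\<Sum>x\<in>nbrs E {u} V. card (ball_on E V k x \<inter> ?Z))" by (rule card_UN_le[OF finN])
    finally have SZ: "card (?S \<inter> ?Z) < D ^ (k + 1) / 4" using ok(2) by linarith
    have "Suc k \<le> J" using J by simp
    then have S: "D ^ Suc k / 2 \<le> card ?S" using ok(1) L_ge[of "Suc k"] unfolding layers_ok_def by fastforce
    have "card ?S = card (?S \<inter> ?Z) + card (?S - ?Z)" using finS by (metis card_Int_Diff)
    then have "D ^ (k + 1) / 4 \<le> card (?S - ?Z)" using SZ S by simp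
    also have "card (?S - ?Z) \<le> card (separators E u v)"
    proof (intro card_mono)
      show "?S - ?Z \<subseteq> separators E u v"
      proof
        fix s assume s: "s \<in> ?S - ?Z"
        have "s \<in> V" using s layer_subset by blast
        moreover have "gdist E s u + 1 < gdist E s v"
        proof (rule layer_separates[OF E(1) uv E(2) V_def])
          show "s \<in> ?S" using s by (rule DiffD1)
          \<comment> \<open>The radius \<open>J = k + 2\<close> of the explored ball is exactly what
            \<open>layer_separates\<close> requires for layer \<open>k + 1\<close>.\<close>
          fix i assume "i \<le> k + 2"
          then have "layer E i {v} V \<subseteq> ?Z" unfolding explored_def J[symmetric] by (intro UN_upper) simp
          then show "s \<notin> layer E i {v} V" using s by blast
        qed
        ultimately show "s \<in> separators E u v" using V(4) by (auto simp: separators_def)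
      qed
    qed (simp add: separators_def)
    finally show ?thesis by simp
  qed
  have "measure_pmf.prob (Gnp n p) {E. \<not> adj E u v \<and> card (separators E u v) < D ^ (k + 1) / 4}
    \<le> measure_pmf.prob (random_edges (vpairs n) p) ({E. ?P (E \<inter> Q1) \<or> ?R E} \<union> {E. \<not> layers_ok E u V})"
    unfolding Gnp_eq_random_edges
  proof (rule measure_pmf.finite_measure_mono_AE, intro AE_pmfI impI)
    fix E assume E: "E \<in> set_pmf (random_edges (vpairs n) p)"
      "E \<in> {E. \<not> adj E u v \<and> card (separators E u v) < D ^ (k + 1) / 4}"
    have "E \<subseteq> vpairs n" using set_random_edges[OF _ E(1)] by simp
    from many[OF this] E(2) show "E \<in> {E. ?P (E \<inter> Q1) \<or> ?R E} \<union> {E. \<not> layers_ok E u V}"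
      by (auto simp: not_less)
  qed auto
  also have "\<dots> \<le> ((1 + real (card V)) * ?c + 1 / real n ^ 3) + ?c"
    by (rule order.trans[OF measure_Un_le add_mono[OF PR Pu]]) auto
  \<comment> \<open>The roots \<open>v\<close>, \<open>u\<close> and the \<open>n - 2\<close>
    elements of \<open>V\<close> make \<open>n\<close> in total.\<close>
  also have "\<dots> = real n * ?c + 1 / real n ^ 3"
  proof -
    have "(1 + x) * c + y + c = (x + 2) * c + y" for x y c :: real by (simp add: algebra_simps)
    moreover have "real (card V) + 2 = real n" using cardV by linarith
    ultimately show ?thesis by metis
  qed
  also have "\<dots> \<le> 5 / real n"
  proof -
    have "real J \<le> real n"
    proof -
      have "real J \<le> 2 ^ J" by (metis less_imp_le of_nat_less_two_power)
      also have "\<dots> \<le> D ^ J" using D_2000 by (intro power_mono) auto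
      also have "\<dots> \<le> real n" using D_J n_pos by simp
      finally show ?thesis .
    qed
    moreover have "1 \<le> real n * real n" using n_pos mult_mono[of 1 "real n" 1 "real n"] by simp
    ultimately have "2 * real n * real J + 1 \<le> 2 * real n * real n + real n * real n"
      by (intro add_mono mult_left_mono) auto
    also have "\<dots> \<le> 5 * (real n * real n)" by simp
    finally have "(2 * real n * real J + 1) / real n ^ 3 \<le> 5 * (real n * real n) / real n ^ 3"
      by (rule divide_right_mono) simp
    then show ?thesis using n_pos by (simp add: power3_eq_cube add_divide_distrib mult_ac)
  qed
  finally show ?thesis .
qed

end

section \<open>Expected number of queries\<close>

context layered
begin

text \<open>Draw the graph first, then the independent seeds. Separators are at least a
  \<open>1 / (4000 * D^2)\<close> fraction of the vertices, so \<open>4000 * D^2 * ln n\<close>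
  seeds all miss them with probability at most \<open>1 / n\<close>.\<close>

lemma unsplit_rare:
  assumes J: "J = k + 2" and big: "real n / 1000 < D ^ (J + 1)" and uv: "u \<noteq> v" "u < n" "v < n"
    and m: "4000 * D\<^sup>2 * ln (real n) \<le> real m"
  shows "measure_pmf.prob (pair_pmf (Gnp n p) (replicate_pmf m (pmf_of_set {..<n})))
    {z. \<not> adj (fst z) u v \<and> unsplit (snd z) (gdist (fst z)) u v} \<le> 6 / real n"
proof -
  let ?M = "pair_pmf (Gnp n p) (replicate_pmf m (pmf_of_set {..<n}))"
  let ?P = "\<lambda>E. \<not> adj E u v \<and> card (separators E u v) < D ^ (k + 1) / 4"
  let ?R = "\<lambda>E ss. \<not> adj E u v \<and> unsplit ss (gdist E) u v"
  have "measure_pmf.prob ?M {z. ?R (fst z) (snd z)} \<le>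
      measure_pmf.prob ?M {z. ?P (fst z) \<or> ?R (fst z) (snd z)}"
    by (intro measure_pmf.finite_measure_mono) auto
  also have "\<dots> \<le> 5 / real n + 1 / real n"
  proof (rule prob_pair_pmf_le[OF few_separators[OF J uv]])
    fix E assume E: "\<not> ?P E"
    show "measure_pmf.prob (replicate_pmf m (pmf_of_set {..<n})) {ss. ?R E ss} \<le> 1 / real n"
    proof (cases "adj E u v")
      case True
      then show ?thesis by simp
    next
      case False
      let ?T = "separators E u v"
      have T: "?T \<subseteq> {..<n}" by (auto simp: separators_def)
      define r where "r = real (card ?T) / real n"
      have "D ^ (k + 1) / 4 \<le> card ?T" using E False by auto
      \<comment> \<open>Maximality of the radius, \<open>D^(J+1) > n / 1000\<close>, divided by
        \<open>D^2\<close>.\<close>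
      moreover have "real n / (1000 * D\<^sup>2) \<le> D ^ (k + 1)"
        using big D_2000 unfolding J by (simp add: field_simps power2_eq_square)
      then have "real n / (1000 * D\<^sup>2) / 4 \<le> D ^ (k + 1) / 4" by (rule divide_right_mono) simp
      ultimately have "real n / (1000 * D\<^sup>2) / 4 \<le> card ?T" by (rule order.trans[rotated])
      then have r: "1 / (4000 * D\<^sup>2) \<le> r" using n_pos D_2000 by (simp add: r_def field_simps)
      have ne: "{..<n} \<noteq> {}" using n_pos by auto
      have pr: "measure_pmf.prob (pmf_of_set {..<n}) (- ?T) = 1 - r"
      proof -
        have "{..<n} \<inter> - ?T = {..<n} - ?T" by auto
        moreover have "card ({..<n} - ?T) = n - card ?T"
          using T by (simp add: card_Diff_subset finite_subset[OF T])
        moreover have "card ?T \<le> n" using card_mono[OF _ T] by simp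
        ultimately show ?thesis using n_pos measure_pmf_of_set[OF ne, of "- ?T"]
          by (simp add: r_def of_nat_diff field_simps)
      qed
      have r1: "r \<le> 1"
        using measure_nonneg[of "measure_pmf (pmf_of_set {..<n})" "- ?T"] unfolding pr by simp
      have "measure_pmf.prob (replicate_pmf m (pmf_of_set {..<n})) {ss. ?R E ss}
        \<le> measure_pmf.prob (replicate_pmf m (pmf_of_set {..<n})) {ss. set ss \<inter> ?T = {}}"
      proof (intro measure_pmf.finite_measure_mono subsetI)
        fix ss assume "ss \<in> {ss. ?R E ss}"
        then have un: "unsplit ss (gdist E) u v" by simp
        have False if "s \<in> set ss" "s \<in> ?T" for s
        proof -
          have "gdist E s u + 1 < gdist E s v" "gdist E s v \<le> gdist E s u + 1"
            using that un by (auto simp: separators_def unsplit_def)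
          then show False by simp
        qed
        then show "ss \<in> {ss. set ss \<inter> ?T = {}}" by auto
      qed auto
      also have "\<dots> = (1 - r) ^ m" by (simp add: prob_replicate_avoid pr)
      also have "\<dots> \<le> exp (- r) ^ m"
        using r1 exp_ge_add_one_self[of "- r"] by (intro power_mono) auto
      also have "\<dots> = exp (- (m * r))" by (simp add: exp_of_nat_mult[symmetric])
      also have "\<dots> \<le> exp (- ln (real n))"
      proof -
        have "ln (real n) = 4000 * D\<^sup>2 * ln (real n) * (1 / (4000 * D\<^sup>2))" using D_2000 by simp
        also have "\<dots> \<le> m * r" using m r ln_n by (intro mult_mono) auto
        finally show ?thesis by simp
      qed
      also have "\<dots> = 1 / real n" using n_pos by (simp add: exp_minus inverse_eq_divide)
      finally show ?thesis .
    qed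
  qed simp
  also have "\<dots> = 6 / real n" by (simp add: field_simps)
  finally show ?thesis .
qed

text \<open>By linearity, the expected number of candidates is at most
  \<open>n^2 * (p + 6 / n) = n * (D + 6)\<close>: true edges plus false candidates. The seed queries
  dominate.\<close>

lemma expected_queries_seed:
  assumes J: "J = k + 2" and big: "real n / 1000 < D ^ (J + 1)"
  defines "m \<equiv> nat \<lceil>4000 * D\<^sup>2 * ln (real n)\<rceil>"
  shows "expected_queries (map_pmf (seed_strategy n) (replicate_pmf m (pmf_of_set {..<n}))) (Gnp n p)
    \<le> ennreal (4001 * D\<^sup>2 * real n * ln (real n))"
proof -
  let ?S = "replicate_pmf m (pmf_of_set {..<n})"
  let ?M = "pair_pmf (Gnp n p) ?S"
  let ?un = "\<lambda>e z. unsplit (snd z) (gdist (fst z)) (fst e) (snd e)"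
  have m: "4000 * D\<^sup>2 * ln (real n) \<le> real m" "real m \<le> 4000 * D\<^sup>2 * ln (real n) + 1"
    using ln_n by (auto simp: m_def real_nat_ceiling_ge intro!: of_nat_ceiling)
  have prob: "measure_pmf.prob ?M {z. ?un e z} \<le> p + 6 / real n" if e: "e \<in> vpairs n" for e
  proof -
    obtain u v where uv: "e = (u, v)" "u < v" "v < n" using e by (auto simp: vpairs_def)
    have adj: "adj E u v \<longleftrightarrow> (u, v) \<in> E" for E using uv by (simp add: adj_def)
    have "measure_pmf.prob ?M {z. ?un e z} \<le> measure_pmf.prob ?M
        ({z. (u, v) \<in> fst z} \<union> {z. \<not> adj (fst z) u v \<and> unsplit (snd z) (gdist (fst z)) u v})"
      by (intro measure_pmf.finite_measure_mono) (auto simp: uv adj)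
    also have "\<dots> \<le> p + 6 / real n"
    proof (rule order.trans[OF measure_Un_le add_mono])
      have "measure_pmf.prob ?M {z. (u, v) \<in> fst z} =
          measure_pmf.prob (map_pmf fst ?M) {E. (u, v) \<in> E}" by (simp add: vimage_def del: map_fst_pair_pmf)
      also have "\<dots> = p"
        using prob_random_edges_mem[of "vpairs n" e p] e uv p by (simp add: map_fst_pair_pmf Gnp_eq_random_edges)
      finally show "measure_pmf.prob ?M {z. (u, v) \<in> fst z} \<le> p" by simp
      show "measure_pmf.prob ?M {z. \<not> adj (fst z) u v \<and> unsplit (snd z) (gdist (fst z)) u v} \<le> 6 / real n"
        by (rule unsplit_rare[OF J big _ _ _ m(1)]) (use uv in auto)
    qed auto
    finally show ?thesis .
  qed
  have card: "card {(u, v) \<in> vpairs n. unsplit ss (gdist E) u v} = (\<Sum>e\<in>vpairs n. if ?un e (E, ss) then 1 else 0)" for E ss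
    by (simp add: sum.If_cases) (rule arg_cong[where f=card], auto)
  have "expected_queries (map_pmf (seed_strategy n) ?S) (Gnp n p)
    = (\<integral>\<^sup>+z. ennreal_of_enat (num_queries (seed_strategy n (snd z)) (fst z)) \<partial>?M)"
    unfolding expected_queries_def by (simp add: nn_integral_pair_pmf')
  also have "\<dots> = (\<integral>\<^sup>+z. ennreal (real (m * n)) + (\<Sum>e\<in>vpairs n. indicator {z. ?un e z} z) \<partial>?M)"
  proof (intro nn_integral_cong_AE AE_pmfI)
    fix z assume z: "z \<in> set_pmf ?M"
    obtain E ss where Es: "z = (E, ss)" by (cases z)
    have "ss \<in> set_pmf ?S" using z Es by simp
    then have "length ss = m" by (simp add: set_replicate_pmf)
    then have "ennreal_of_enat (num_queries (seed_strategy n (snd z)) (fst z)) =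
        of_nat (m * n) + of_nat (\<Sum>e\<in>vpairs n. if ?un e (E, ss) then 1 else 0)"
      by (simp only: Es fst_conv snd_conv num_queries_seed card ennreal_of_enat_enat of_nat_add)
    also have "of_nat (m * n) = ennreal (real (m * n))" by (simp only: ennreal_of_nat_eq_real_of_nat)
    also have "of_nat (\<Sum>e\<in>vpairs n. if ?un e (E, ss) then 1 else 0) =
        (\<Sum>e\<in>vpairs n. indicator {z. ?un e z} z :: ennreal)"
      unfolding of_nat_sum by (intro sum.cong refl) (simp add: Es)
    finally show "ennreal_of_enat (num_queries (seed_strategy n (snd z)) (fst z)) =
      ennreal (real (m * n)) + (\<Sum>e\<in>vpairs n. indicator {z. ?un e z} z)" .
  qed
  also have "\<dots> = ennreal (real (m * n)) + (\<Sum>e\<in>vpairs n. ennreal (measure_pmf.prob ?M {z. ?un e z}))"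
    by (simp add: nn_integral_add nn_integral_sum measure_pmf.emeasure_eq_measure del: of_nat_mult)
  also have "\<dots> = ennreal (real (m * n) + (\<Sum>e\<in>vpairs n. measure_pmf.prob ?M {z. ?un e z}))"
    by (simp add: sum_ennreal ennreal_plus[symmetric] sum_nonneg del: ennreal_plus of_nat_mult)
  also have "\<dots> \<le> ennreal (4001 * D\<^sup>2 * real n * ln (real n))"
  proof (rule ennreal_leI)
    have "card (vpairs n) \<le> card ({..<n} \<times> {..<n})" by (intro card_mono) (auto simp: vpairs_def)
    then have cv: "real (card (vpairs n)) \<le> real n * real n" by (simp flip: of_nat_mult)
    have "(\<Sum>e\<in>vpairs n. measure_pmf.prob ?M {z. ?un e z}) \<le> (\<Sum>e\<in>vpairs n. p + 6 / real n)"
      by (intro sum_mono prob)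
    also have "\<dots> \<le> real n * real n * (p + 6 / real n)"
      using cv p n_pos by (simp only: sum_constant) (intro mult_right_mono, auto)
    also have "\<dots> = real n * (D + 6)" using n_pos by (simp add: D field_simps)
    finally have "real (m * n) + (\<Sum>e\<in>vpairs n. measure_pmf.prob ?M {z. ?un e z})
      \<le> real n * (real m + D + 6)" by (simp add: algebra_simps)
    also have "\<dots> \<le> real n * (4001 * D\<^sup>2 * ln (real n))"
    proof (rule mult_left_mono)
      \<comment> \<open>The 7 collects the 6 from false candidates and 1 from rounding up
        \<open>m\<close>; absorbing all of it raises 4000 to 4001.\<close>
      have "D + 7 \<le> D * 2" using D_2000 by simp
      also have "\<dots> \<le> D * D" using D_2000 by (intro mult_left_mono) auto
      also have "\<dots> \<le> D * D * ln (real n)" using ln_n D_2000 mult_left_mono[of 1 "ln (real n)" "D * D"] by simp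
      finally show "real m + D + 6 \<le> 4001 * D\<^sup>2 * ln (real n)" using m(2) by (simp add: power2_eq_square)
    qed simp
    finally show "real (m * n) + (\<Sum>e\<in>vpairs n. measure_pmf.prob ?M {z. ?un e z})
      \<le> 4001 * D\<^sup>2 * real n * ln (real n)" by (simp add: mult_ac)
  qed
  finally show ?thesis .
qed

end

text \<open>Without seeds every pair is vacuously unsplit, so the same strategy serves as brute
  force.\<close>

lemma expected_queries_all_pairs:
  "expected_queries (return_pmf (seed_strategy n [])) G \<le> ennreal (real (card (vpairs n)))"
proof -
  have "num_queries (seed_strategy n []) E = enat (card (vpairs n))" for E
  proof -
    have "{(u, v) \<in> vpairs n. unsplit [] (gdist E) u v} = vpairs n" by (auto simp: unsplit_def)
    then show ?thesis by (simp add: num_queries_seed)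
  qed
  then show ?thesis
    by (simp add: expected_queries_def nn_integral_pair_pmf' ennreal_of_nat_eq_real_of_nat
        measure_pmf.emeasure_space_1[simplified])
qed

lemma seed_strategies_reconstruct:
  "\<forall>E\<in>set_pmf (Gnp n p). \<forall>S\<in>set_pmf (map_pmf (seed_strategy n) M). reconstructs S E"
  using set_random_edges[of "vpairs n"] reconstructs_seed by (auto simp: Gnp_eq_random_edges)

text \<open>The two bounds on \<open>p\<close> together give \<open>2000 * ln n <= sqrt n\<close>,
  which rules out small \<open>n\<close>; \<open>ln n >= 1/2\<close> already yields
  \<open>sqrt n >= 3\<close>, hence \<open>n >= 9 > e\<close>.\<close>

lemma sparse_regime_bounds:
  assumes n: "2 \<le> n" and lo: "2000 * ln (real n) / real n \<le> p" and hi: "p \<le> real n powr (- (1 / 2))"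
  shows "0 \<le> p" "p \<le> 1" "2000 * ln (real n) \<le> real n * p" "1 \<le> ln (real n)"
proof -
  have ln_pos: "0 < ln (real n)" using n by simp
  show "0 \<le> p" using order.trans[OF _ lo, of 0] ln_pos n by simp
  have "real n powr (- (1 / 2)) \<le> real n powr 0" using n by (intro powr_mono) auto
  then show "p \<le> 1" using hi n by simp
  show np: "2000 * ln (real n) \<le> real n * p" using lo n by (simp add: field_simps)
  have "real n * p \<le> real n * real n powr (- (1 / 2))" using hi by (intro mult_left_mono) auto
  also have "\<dots> = real n powr (1 / 2)"
    using n powr_mult_base[of "real n" "- (1 / 2)"] by simp
  also have "\<dots> = sqrt (real n)" by (rule powr_half_sqrt) simp
  finally have "2000 * ln (real n) \<le> sqrt (real n)" using np by simp
  moreover have "ln 2 \<le> ln (real n)" using n by simp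
  moreover have "1 / 2 \<le> ln (2 :: real)"
    using ln_2_less_1 ln_le_minus_one[of "1 / 2 :: real"] by (simp add: ln_div)
  ultimately have "3 \<le> sqrt (real n)" by linarith
  then have "3 ^ 2 \<le> (sqrt (real n)) ^ 2" by (intro power_mono) auto
  then have "exp 1 \<le> real n" using exp_le by simp
  then show "1 \<le> ln (real n)" using n by (simp add: ln_ge_iff)
qed

theorem theorem1:
  "\<forall>\<epsilon>::real. \<epsilon> \<ge> 0 \<longrightarrow> (\<exists>C::real. C > 0 \<and>
     (\<forall>(n::nat) (p::real).
        2000 * ln (real n) / real n \<le> p \<and> p \<le> real n powr (- (1/2) - \<epsilon>) \<longrightarrow>
        (\<exists>A :: strategy pmf.
           (\<forall>E\<in>set_pmf (Gnp n p). \<forall>S\<in>set_pmf A. reconstructs S E) \<and>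
           expected_queries A (Gnp n p)
             \<le> ennreal (C * ((real n - 1) * p)\<^sup>2 * real n * ln (real n)))))"
proof (intro allI impI)
  fix \<epsilon> :: real assume \<epsilon>: "\<epsilon> \<ge> 0"
  \<comment> \<open>The constant does not depend on \<open>\<epsilon>\<close>: 16004 is 4 * 4001,
    the 4 coming from replacing \<open>n * p\<close> by \<open>(n - 1) * p\<close> inside the
    square.\<close>
  have main: "\<exists>A :: strategy pmf.
           (\<forall>E\<in>set_pmf (Gnp n p). \<forall>S\<in>set_pmf A. reconstructs S E) \<and>
           expected_queries A (Gnp n p) \<le> ennreal (16004 * ((real n - 1) * p)\<^sup>2 * real n * ln (real n))"
    if lo: "2000 * ln (real n) / real n \<le> p" and hi: "p \<le> real n powr (- (1/2) - \<epsilon>)" for n :: nat and p :: real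
  proof -
    have all_pairs: ?thesis if "real (card (vpairs n)) \<le> 16004 * ((real n - 1) * p)\<^sup>2 * real n * ln (real n)"
      using seed_strategies_reconstruct[of n p "return_pmf []"]
        order.trans[OF expected_queries_all_pairs ennreal_leI[OF that]]
      by (intro exI[of _ "return_pmf (seed_strategy n [])"]) (simp add: map_return_pmf)
    show ?thesis
    proof (cases "2 \<le> n")
      case False
      then have "vpairs n = {}" by (auto simp: vpairs_def)
      \<comment> \<open>Here \<open>n\<close> is 0 or 1; for \<open>n = 0\<close> this relies on the
        value that HOL assigns to \<open>ln 0\<close>.\<close>
      moreover have "0 \<le> ln (real n)" using False by (cases "n = 0") auto
      ultimately show ?thesis by (intro all_pairs) simp
    next
      case True
      have "real n powr (- (1/2) - \<epsilon>) \<le> real n powr (- (1/2))" using True \<epsilon> by (intro powr_mono) auto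
      then have hi': "p \<le> real n powr (- (1/2))" using hi by linarith
      note b = sparse_regime_bounds[OF True lo hi']
      define D where "D = real n * p"
      have n0: "0 < real n" using True by simp
      have D2000: "2000 \<le> D" using b(3,4) by (simp add: D_def)
      have D4: "D\<^sup>2 \<le> 4 * ((real n - 1) * p)\<^sup>2"
      proof -
        have "real n * p \<le> (2 * (real n - 1)) * p" using True b(1) by (intro mult_right_mono) auto
        then have "D \<le> 2 * ((real n - 1) * p)" unfolding D_def by (simp only: mult.assoc)
        then have "D\<^sup>2 \<le> (2 * ((real n - 1) * p))\<^sup>2"
          using D2000 by (intro power_mono) auto
        then show ?thesis by (simp add: power2_eq_square)
      qed
      have scale: "c * D\<^sup>2 * real n * ln (real n) \<le> 16004 * ((real n - 1) * p)\<^sup>2 * real n * ln (real n)"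
        if "0 \<le> c" "c \<le> 4001" for c
      proof -
        have "c * D\<^sup>2 \<le> 4001 * (4 * ((real n - 1) * p)\<^sup>2)" using that D4 by (intro mult_mono) auto
        then show ?thesis using b(4) by (intro mult_right_mono) auto
      qed
      show ?thesis
      proof (cases "D\<^sup>2 \<le> real n / 1000")
        case False
        have "card (vpairs n) \<le> card ({..<n} \<times> {..<n})" by (intro card_mono) (auto simp: vpairs_def)
        then have "real (card (vpairs n)) \<le> real n * real n" by (simp flip: of_nat_mult)
        also have "\<dots> \<le> (1000 * D\<^sup>2) * real n" using False by (intro mult_right_mono) auto
        also have "\<dots> \<le> 1000 * D\<^sup>2 * real n * ln (real n)"
          using b(4) mult_left_mono[of 1 "ln (real n)" "1000 * D\<^sup>2 * real n"] by simp
        also have "\<dots> \<le> 16004 * ((real n - 1) * p)\<^sup>2 * real n * ln (real n)" by (rule scale) auto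
        finally show ?thesis by (rule all_pairs)
      next
        case small: True
        have "\<exists>i. real n / 1000 < D ^ i" using D2000 by (intro real_arch_pow) simp
        \<comment> \<open>\<open>I\<close> is the first exponent beyond the maximal radius, so
          \<open>J = I - 1\<close>; having \<open>I >= 3\<close> lets \<open>J\<close> be written as
          \<open>k + 2\<close>.\<close>
        define I where "I = (LEAST i. real n / 1000 < D ^ i)"
        have I: "real n / 1000 < D ^ I" unfolding I_def by (rule LeastI_ex) fact
        have I_least: "D ^ i \<le> real n / 1000" if "i < I" for i
          using not_less_Least[OF that[unfolded I_def]] by (simp only: not_less)
        have "2 < I"
        proof (rule ccontr)
          assume "\<not> 2 < I"
          then have "D ^ I \<le> D\<^sup>2" using D2000 by (intro power_increasing) auto
          then show False using I small by linarith
        qed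
        then obtain k where k: "I = k + 3" by (metis add.commute le_Suc_ex Suc_leI eval_nat_numeral(3))
        interpret layered n "k + 2" p D
          by unfold_locales (use b I_least[of "k + 2"] k in \<open>auto simp: D_def\<close>)
        show ?thesis
          using expected_queries_seed[OF refl] I k seed_strategies_reconstruct
            order.trans[OF expected_queries_seed[OF refl] ennreal_leI[OF scale]]
          by (intro exI[of _ "map_pmf (seed_strategy n) (replicate_pmf (nat \<lceil>4000 * D\<^sup>2 * ln (real n)\<rceil>) (pmf_of_set {..<n}))"])
            (auto simp: eval_nat_numeral)
      qed
    qed
  qed
  show "\<exists>C::real. C > 0 \<and>
     (\<forall>(n::nat) (p::real).
        2000 * ln (real n) / real n \<le> p \<and> p \<le> real n powr (- (1/2) - \<epsilon>) \<longrightarrow>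
        (\<exists>A :: strategy pmf.
           (\<forall>E\<in>set_pmf (Gnp n p). \<forall>S\<in>set_pmf A. reconstructs S E) \<and>
           expected_queries A (Gnp n p)
             \<le> ennreal (C * ((real n - 1) * p)\<^sup>2 * real n * ln (real n))))"
    using main by (intro exI[of _ 16004]) auto
qed

end
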